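(* Let $Y_N=\begin{bmatrix} y_{11}&y_{12}&y_{13}\\ y_{12}&y_{22}&y_{23}\\ y_{13}&y_{23}&y_{33}\end{bmatrix}$ be a third-order real symmetric matrix. Then $Y_N$ can be realized as the admittance of a three-port resistive network with at most three elements if and only if one of the following two conditions holds: 1. $y_{12}y_{13}y_{23}\le 0$, $y_{11}-|y_{12}|-|y_{13}|\ge 0$, $y_{22}-|y_{12}|-|y_{23}|\ge 0$, $y_{33}-|y_{13}|-|y_{23}|\ge 0$, and at least three of the six quantities $y_{12}$, $y_{13}$, $y_{23}$, $y_{11}-|y_{12}|-|y_{13}|$, $y_{22}-|y_{12}|-|y_{23}|$, $y_{33}-|y_{13}|-|y_{23}|$ are zero. 2. $y_{12}y_{13}y_{23}\ge 0$ and at least one of the following three conditions (each a system of six inequalities) holds with at least three of its six inequality signs being equality: (a) $-|y_{13}|\le 0$, $|y_{13}|\le|y_{12}|\le y_{11}$, $|y_{13}|\le|y_{23}|\le y_{33}$, and $|y_{12}|+|y_{23}|-|y_{13}|\le y_{22}$; (b) $-|y_{12}|\le 0$, $|y_{12}|\le|y_{13}|\le y_{11}$, $|y_{12}|\le|y_{23}|\le y_{22}$, and $|y_{13}|+|y_{23}|-|y_{12}|\le y_{33}$; (c) $-|y_{23}|\le 0$, $|y_{23}|\le|y_{12}|\le y_{22}$, $|y_{23}|\le|y_{13}|\le y_{33}$, and $|y_{12}|+|y_{13}|-|y_{23}|\le y_{11}$.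
   Context: An $n$-port resistive network consists of a finite set of nodes, a finite set of elements (resistors, each joining two nodes and having a positive conductance; no transformers), and $n$ ports, each port being an ordered pair of distinct nodes (positive and negative terminal). Its augmented graph $\mathcal{G}$ has the nodes as vertices and one edge for each element and each port (parallel edges allowed); $\mathcal{G}$ is assumed connected. Given port voltages $v\in\mathbb{R}^n$ (differences of node potentials across the ports), port currents $i\in\mathbb{R}^n$ (injected at the positive terminal and extracted at the negative terminal of each port) are determined by Kirchhoff's laws and Ohm's law. The network has a (well-defined) admittance $Y\in\mathbb{R}^{n\times n}$ if for every $v\in\mathbb{R}^n$ there is a unique compatible $i$; then $i=Yv$. A matrix is realized by a network if the network has a well-defined admittance equal to that matrix. The number of nodes of the network is not restricted. *)

theory Defs
  imports "Graph_Theory.Digraph_Component" "HOL-Analysis.Analysis"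
begin

text \<open>
  A resistive network with nodes in \<open>'v\<close>, element names in \<open>'e\<close> and ports indexed by the finite
  type \<open>'n\<close>. Named elements and ports allow parallel edges. The order of the two end nodes of an
  element only fixes a reference direction for its current; a port is the pair of its positive and
  its negative terminal.
\<close>

record ('v, 'e, 'n) network =
  nodes :: "'v set"
  elements :: "'e set"
  ends :: "'e \<Rightarrow> 'v \<times> 'v"
  conductance :: "'e \<Rightarrow> real"
  port :: "'n \<Rightarrow> 'v \<times> 'v"

definition augmented_graph :: "('v, 'e, 'n) network \<Rightarrow> ('v, 'e + 'n) pre_digraph" where
  "augmented_graph N =
    \<lparr> verts = nodes N,
      arcs = elements N <+> UNIV,
      tail = case_sum (\<lambda>e. fst (ends N e)) (\<lambda>k. fst (port N k)),
      head = case_sum (\<lambda>e. snd (ends N e)) (\<lambda>k. snd (port N k)) \<rparr>"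

text \<open>
  Connectedness below is that of the underlying undirected multigraph. The name is qualified
  because of the topological notion of the same name.
\<close>

definition resistive_network :: "('v, 'e, 'n::finite) network \<Rightarrow> bool" where
  "resistive_network N \<longleftrightarrow>
    fin_digraph (augmented_graph N) \<and>
    loopfree_digraph (augmented_graph N) \<and>
    Digraph_Component.connected (augmented_graph N) \<and>
    (\<forall>e\<in>elements N. conductance N e > 0)"

text \<open>
  The function \<open>u\<close> assigns potentials to the nodes (Kirchhoff's voltage law) and \<open>c\<close> assigns currents
  to the elements, in the direction from first to second end node. The last conjunct is Kirchhoff's
  current law: the net current leaving a node through the elements is the net current injected there
  by the ports.
\<close>

definition compatible :: "('v, 'e, 'n::finite) network \<Rightarrow> real ^ 'n \<Rightarrow> real ^ 'n \<Rightarrow> bool" where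
  "compatible N v i \<longleftrightarrow>
    (\<exists>(u :: 'v \<Rightarrow> real) (c :: 'e \<Rightarrow> real).
      (\<forall>k. v $ k = u (fst (port N k)) - u (snd (port N k))) \<and>
      (\<forall>e\<in>elements N. c e = conductance N e * (u (fst (ends N e)) - u (snd (ends N e)))) \<and>
      (\<forall>x\<in>nodes N.
        (\<Sum>e | e \<in> elements N \<and> fst (ends N e) = x. c e)
          - (\<Sum>e | e \<in> elements N \<and> snd (ends N e) = x. c e)
        = (\<Sum>k | fst (port N k) = x. i $ k) - (\<Sum>k | snd (port N k) = x. i $ k)))"

definition well_defined_admittance :: "('v, 'e, 'n::finite) network \<Rightarrow> bool" where
  "well_defined_admittance N \<longleftrightarrow> (\<forall>v. \<exists>!i. compatible N v i)"

definition realizes :: "('v, 'e, 'n::finite) network \<Rightarrow> real ^ 'n ^ 'n \<Rightarrow> bool" where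
  "realizes N Y \<longleftrightarrow>
    resistive_network N \<and> well_defined_admittance N \<and> (\<forall>v i. compatible N v i \<longrightarrow> i = Y *v v)"

text \<open>
  Since nodes and elements are finite in number, taking their names from \<open>nat\<close> is no restriction.
\<close>

definition realizable_with_at_most :: "nat \<Rightarrow> real ^ 'n ^ 'n::finite \<Rightarrow> bool" where
  "realizable_with_at_most m Y \<longleftrightarrow>
    (\<exists>N :: (nat, nat, 'n) network. realizes N Y \<and> card (elements N) \<le> m)"

definition at_least_zero :: "nat \<Rightarrow> real list \<Rightarrow> bool" where
  "at_least_zero m qs \<longleftrightarrow> length (filter (\<lambda>q. q = 0) qs) \<ge> m"

text \<open>
  A pair \<open>(l, r)\<close> stands for the inequality \<open>l \<le> r\<close>; all of them hold, at least \<open>m\<close> with equality.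
\<close>

definition inequalities_with_equalities :: "nat \<Rightarrow> (real \<times> real) list \<Rightarrow> bool" where
  "inequalities_with_equalities m ps \<longleftrightarrow>
    (\<forall>(l, r)\<in>set ps. l \<le> r) \<and> length (filter (\<lambda>(l, r). l = r) ps) \<ge> m"

end

theory Submission
  imports Defs
begin

text \<open>
  Testing Kirchhoff's current law against arbitrary potentials \<open>\<phi>\<close> turns the network into the identity
  \<open>\<Sum> g \<Delta>u \<Delta>\<phi> = \<Sum> (Y v) \<Delta>\<phi>\<close> (elements on the left, ports on the right). As long as some set \<open>S\<close> of at most
  two nodes is closed under the ports and is not everything, a node of \<open>S\<close> can be merged with an outside
  node: no net current crosses the boundary of \<open>S\<close>, so the at most three crossing elements can be replaced
  by a loop, a series connection, or, after a star-triangle transformation, a triangle. When no merge is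
  possible, the three ports form a spanning tree on four nodes, which is a star or a path. Then \<open>Y\<close> is a sum
  of six rank-one terms, one per pair of nodes, whose weights are, up to sign, the six quantities in the theorem,
  and at most three elements means at least three vanishing weights. Conversely, the six weights are used
  as conductances on four nodes.
\<close>

section \<open>The variational form of Kirchhoff's laws\<close>

text \<open>Elements are triples (end node, end node, conductance); conductance 0 and loops are harmless.\<close>

definition energy :: "('v \<times> 'v \<times> real) list \<Rightarrow> ('v \<Rightarrow> real) \<Rightarrow> ('v \<Rightarrow> real) \<Rightarrow> real" where
  "energy es u \<phi> = (\<Sum>(p, q, g)\<leftarrow>es. g * (u p - u q) * (\<phi> p - \<phi> q))"

definition edge_nodes :: "('v \<times> 'v \<times> real) list \<Rightarrow> 'v set" where
  "edge_nodes es = (\<Union>(p, q, g)\<in>set es. {p, q})"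

text \<open>The potential \<open>u\<close> attains the port voltages \<open>v\<close>, and the
  identity in the test potential \<phi> is Kirchhoff's current law with port currents
  \<open>Y *v v\<close>. Terminals are given by functions \<open>a\<close> and \<open>b\<close>, so
  identifying nodes is composition with a map.\<close>

definition has_admittance ::
  "('v \<times> 'v \<times> real) list \<Rightarrow> ('n \<Rightarrow> 'v) \<Rightarrow> ('n \<Rightarrow> 'v) \<Rightarrow> real ^ 'n ^ 'n::finite \<Rightarrow> bool" where
  "has_admittance es a b Y \<longleftrightarrow>
    (\<forall>v. \<exists>u. (\<forall>k. u (a k) - u (b k) = v $ k) \<and>
      (\<forall>\<phi>. energy es u \<phi> = (\<Sum>k\<in>UNIV. (Y *v v) $ k * (\<phi> (a k) - \<phi> (b k)))))"

lemma energy_simps [simp]: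
  "energy [] u \<phi> = 0"
  "energy ((p, q, g) # es) u \<phi> = g * (u p - u q) * (\<phi> p - \<phi> q) + energy es u \<phi>"
  "energy (es @ es') u \<phi> = energy es u \<phi> + energy es' u \<phi>"
  by (simp_all add: energy_def)

lemma energy_map:
  "energy (map (map_prod f (map_prod f id)) es) u \<phi> = energy es (u \<circ> f) (\<phi> \<circ> f)"
  by (induction es) auto

lemma edge_nodes_simps [simp]:
  "edge_nodes [] = {}"
  "edge_nodes ((p, q, g) # es) = insert p (insert q (edge_nodes es))"
  "edge_nodes (es @ es') = edge_nodes es \<union> edge_nodes es'"
  by (auto simp: edge_nodes_def)

lemma finite_edge_nodes [simp]: "finite (edge_nodes es)"
  by (auto simp: edge_nodes_def)

lemma edge_nodes_map:
  "edge_nodes (map (map_prod f (map_prod f id)) es) = f ` edge_nodes es"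
  by (induction es) auto

section \<open>Merging port components\<close>

text \<open>Without net current two elements act in series; \<open>w1\<close> and \<open>w2\<close>
  are their drops. If the conductances sum to 0, both vanish and both sides are 0.\<close>

lemma series_current:
  fixes g1 g2 w1 w2 :: real
  assumes "0 \<le> g1" "0 \<le> g2" "g1 * w1 + g2 * w2 = 0"
  shows "g1 * g2 / (g1 + g2) * (w1 - w2) = g1 * w1"
proof (cases "g1 + g2 = 0")
  case True
  then show ?thesis using assms by (simp add: add_nonneg_eq_0_iff)
next
  case False
  have "g1 * g2 * (w1 - w2) = g1 * w1 * (g1 + g2)"
    using assms(3) by algebra
  then show ?thesis using False by (simp add: field_simps)
qed

text \<open>The triangle with sides \<open>gi * gj / G\<close> carries the same leaf currents as the
  star. \<open>f1\<close> and \<open>f2\<close> are drops of a test potential whose third drop is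
  normalised to 0, as happens when the third element is contracted. After multiplication by
  \<open>G\<close> this is a polynomial consequence of the balance equation.\<close>

lemma star_triangle:
  fixes g1 g2 g3 w1 w2 w3 f1 f2 :: real
  assumes "0 \<le> g1" "0 \<le> g2" "0 \<le> g3" "g1 * w1 + g2 * w2 + g3 * w3 = 0"
  defines "G \<equiv> g1 + g2 + g3"
  shows "g1 * g3 / G * (w1 - w3) * f1 + g2 * g3 / G * (w2 - w3) * f2
      + g1 * g2 / G * (w1 - w2) * (f1 - f2) = g1 * w1 * f1 + g2 * w2 * f2"
proof (cases "G = 0")
  case True
  then have "g1 = 0" "g2 = 0" using assms by linarith+
  then show ?thesis by simp
next
  case False
  have "g1 * g3 * (w1 - w3) * f1 + g2 * g3 * (w2 - w3) * f2 + g1 * g2 * (w1 - w2) * (f1 - f2)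
      = (g1 * w1 * f1 + g2 * w2 * f2) * G"
    using assms(4) unfolding G_def by algebra
  then have "(g1 * g3 * (w1 - w3) * f1 + g2 * g3 * (w2 - w3) * f2 + g1 * g2 * (w1 - w2) * (f1 - f2)) / G
      = g1 * w1 * f1 + g2 * w2 * f2"
    using False by simp
  then show ?thesis by (simp add: add_divide_distrib)
qed

text \<open>Shifting \<open>S\<close> lifts \<open>r\<close> to the potential of \<open>p3\<close>,
  and the drop from \<open>p1\<close> to \<open>q\<close> becomes the difference of the drops across
  the first and the third element. Hence the triangle sides that would end in \<open>p3\<close> can
  end in \<open>q\<close>.\<close>

lemma merge_three_crossing:
  fixes p1 p2 p3 q r :: 'v
  assumes p: "p1 \<notin> S" "p2 \<notin> S" "p3 \<notin> S" and q: "q \<in> S" "r \<in> S"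
    and g: "0 \<le> g1" "0 \<le> g2" "0 \<le> g3"
  defines "G \<equiv> g1 + g2 + g3"
  assumes bal: "g1 * (u p1 - u q) + g2 * (u p2 - u q) + g3 * (u p3 - u r) = 0"
    and \<phi>: "\<phi> r = \<phi> p3"
  shows "energy [(p1, q, g1 * g3 / G), (p2, q, g2 * g3 / G), (p1, p2, g1 * g2 / G)]
      (\<lambda>z. if z \<in> S then u z + (u p3 - u r) else u z) \<phi>
    = energy [(p1, q, g1), (p2, q, g2), (p3, r, g3)] u \<phi>"
  using star_triangle[OF g bal, of "\<phi> p1 - \<phi> q" "\<phi> p2 - \<phi> q"] p q \<phi>
  by (simp add: G_def algebra_simps)

text \<open>
  The balance condition says that no net current leaves \<open>S\<close>. Since \<open>S\<close> has at most two nodes, two of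
  three crossing elements share their end in \<open>S\<close>, so if the third one is contracted, every side of the
  equivalent triangle joins two existing nodes.
\<close>

lemma merge_crossing:
  fixes C :: "('v \<times> 'v \<times> real) list"
  assumes len: "length C \<le> 3"
    and C: "\<forall>(p, q, g)\<in>set C. p \<notin> S \<and> q \<in> S \<and> 0 \<le> g"
    and S: "S \<subseteq> {x, y}" "s0 \<in> S" "t0 \<notin> S"
  shows "\<exists>s t C'. s \<in> S \<and> t \<notin> S \<and> {s, t} \<subseteq> {s0, t0} \<union> edge_nodes C \<and>
    length C' \<le> length C \<and> (\<forall>(p, q, g)\<in>set C'. 0 \<le> g) \<and> edge_nodes C' \<subseteq> edge_nodes C \<and>
    (\<forall>u \<phi>. (\<Sum>(p, q, g)\<leftarrow>C. g * (u p - u q)) = 0 \<longrightarrow> \<phi> s = \<phi> t \<longrightarrow>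
      energy C' (\<lambda>z. if z \<in> S then u z + (u t - u s) else u z) \<phi> = energy C u \<phi>)"
proof -
  consider "C = []" | p q g where "C = [(p, q, g)]"
    | p1 q1 g1 p2 q2 g2 where "C = [(p1, q1, g1), (p2, q2, g2)]"
    | p1 q1 g1 p2 q2 g2 p3 q3 g3 where "C = [(p1, q1, g1), (p2, q2, g2), (p3, q3, g3)]"
  proof -
    have "length C = 0 \<or> length C = 1 \<or> length C = 2 \<or> length C = 3" using len by linarith
    then show ?thesis using that
      by (auto simp: length_Suc_conv numeral_2_eq_2 numeral_3_eq_3)
  qed
  then show ?thesis
  proof cases
    case 1
    \<comment> \<open>Without crossing elements \<open>S\<close> floats freely, so the given pair
      \<open>s0\<close>, \<open>t0\<close> can be merged.\<close>
    then show ?thesis using S by (intro exI[of _ s0] exI[of _ t0] exI[of _ "[]"]) auto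
  next
    case (2 p q g)
    \<comment> \<open>Contraction turns the only element into a loop: \<phi> agrees on its ends, so
      it contributes 0 before and after.\<close>
    then show ?thesis using C by (intro exI[of _ q] exI[of _ p] exI[of _ C]) auto
  next
    case (3 p1 q1 g1 p2 q2 g2)
    \<comment> \<open>The second element is contracted; the first keeps its ends and takes the
      series conductance.\<close>
    have "energy [(p1, q1, g1 * g2 / (g1 + g2))] (\<lambda>z. if z \<in> S then u z + (u p2 - u q2) else u z) \<phi>
        = energy C u \<phi>"
      if bal: "(\<Sum>(p, q, g)\<leftarrow>C. g * (u p - u q)) = 0" and \<phi>: "\<phi> q2 = \<phi> p2" for u \<phi>
    proof -
      have "g1 * g2 / (g1 + g2) * (u p1 - u q1 - (u p2 - u q2)) = g1 * (u p1 - u q1)"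
        using bal C 3 by (intro series_current) auto
      then have "g1 * g2 / (g1 + g2) * (u p1 - (u q1 + (u p2 - u q2))) = g1 * (u p1 - u q1)"
        by (simp only: diff_diff_eq)
      then show ?thesis
        using C \<phi> unfolding 3 energy_simps by simp
    qed
    then show ?thesis using C 3
      by (intro exI[of _ q2] exI[of _ p2] exI[of _ "[(p1, q1, g1 * g2 / (g1 + g2))]"]) auto
  next
    case (4 p1 q1 g1 p2 q2 g2 p3 q3 g3)
    have nn: "0 \<le> g1" "0 \<le> g2" "0 \<le> g3" and p: "p1 \<notin> S" "p2 \<notin> S" "p3 \<notin> S"
      and q: "q1 \<in> S" "q2 \<in> S" "q3 \<in> S"
      using C 4 by auto
    let ?G = "g1 + g2 + g3"
    have "q1 = q2 \<or> q1 = q3 \<or> q2 = q3" using q S by auto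
    then show ?thesis
    proof (elim disjE)
      assume e: "q1 = q2"
      show ?thesis
        using nn p q merge_three_crossing[OF p q(1,3) nn] unfolding 4 e
        by (intro exI[of _ q3] exI[of _ p3]
            exI[of _ "[(p1, q1, g1 * g3 / ?G), (p2, q1, g2 * g3 / ?G), (p1, p2, g1 * g2 / ?G)]"])
           (auto simp: e algebra_simps)
    next
      assume e: "q1 = q3"
      show ?thesis
        using nn p q merge_three_crossing[OF p(1,3,2) q(1,2) nn(1,3,2)] unfolding 4 e
        by (intro exI[of _ q2] exI[of _ p2]
            exI[of _ "[(p1, q1, g1 * g2 / ?G), (p3, q1, g3 * g2 / ?G), (p1, p3, g1 * g3 / ?G)]"])
           (auto simp: e algebra_simps)
    next
      assume e: "q2 = q3"
      show ?thesis
        using nn p q merge_three_crossing[OF p(2,3,1) q(2,1) nn(2,3,1)] unfolding 4 e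
        by (intro exI[of _ q1] exI[of _ p1]
            exI[of _ "[(p2, q2, g2 * g1 / ?G), (p3, q2, g3 * g1 / ?G), (p2, p3, g2 * g3 / ?G)]"])
           (auto simp: e algebra_simps)
    qed
  qed
qed

section \<open>Contraction along a node set closed under the ports\<close>

lemma energy_filter:
  "energy es u \<phi> = energy (filter (\<lambda>e. \<not> P e) es) u \<phi> + energy (filter P es) u \<phi>"
  by (induction es) auto

lemma energy_orient:
  "energy (map (\<lambda>(p, q, g). if q \<in> S then (p, q, g) else (q, p, g)) es) u \<phi> = energy es u \<phi>"
  by (induction es) (auto simp: algebra_simps)

lemma edge_nodes_orient:
  "edge_nodes (map (\<lambda>(p, q, g). if q \<in> S then (p, q, g) else (q, p, g)) es) = edge_nodes es"
  by (induction es) (auto split: if_splits)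

lemma edge_nodes_filter: "edge_nodes (filter P es) \<subseteq> edge_nodes es"
  by (auto simp: edge_nodes_def)

text \<open>A common shift of the potentials on \<open>S\<close> changes neither a port voltage nor
  the current of an element that does not cross. So \<open>S\<close> can be shifted until some
  \<open>s\<close> inside and some \<open>t\<close> outside have equal potential, and then both are
  identified; \<open>merge_crossing\<close> replaces the crossing elements.\<close>

lemma merge_admittance:
  fixes es :: "('v \<times> 'v \<times> real) list" and a b :: "'n::finite \<Rightarrow> 'v"
  assumes Y: "has_admittance es a b Y"
    and len: "length es \<le> 3" and nn: "\<forall>(p, q, g)\<in>set es. 0 \<le> g"
    and closed: "\<And>k. a k \<in> S \<longleftrightarrow> b k \<in> S"
    and S: "S \<subseteq> {x, y}" "s0 \<in> S" "t0 \<notin> S"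
  shows "\<exists>s t es'. s \<in> S \<and> t \<notin> S \<and> {s, t} \<subseteq> {s0, t0} \<union> edge_nodes es \<and>
    length es' \<le> length es \<and> (\<forall>(p, q, g)\<in>set es'. 0 \<le> g) \<and>
    edge_nodes es' \<subseteq> id(s := t) ` edge_nodes es \<and>
    has_admittance es' (id(s := t) \<circ> a) (id(s := t) \<circ> b) Y"
proof -
  define cross where "cross = (\<lambda>(p, q, g :: real). p \<in> S \<longleftrightarrow> q \<notin> S)"
  define R where "R = filter (\<lambda>e. \<not> cross e) es"
  \<comment> \<open>Reversing an element leaves \<open>energy\<close> unchanged, so all crossing
    elements may point into \<open>S\<close>.\<close>
  define C where "C = map (\<lambda>(p, q, g). if q \<in> S then (p, q, g) else (q, p, g)) (filter cross es)"
  have split: "energy es u \<phi> = energy R u \<phi> + energy C u \<phi>" for u \<phi>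
    unfolding R_def C_def energy_orient by (rule energy_filter)
  have lenRC: "length R + length C = length es"
    unfolding R_def C_def using sum_length_filter_compl[of cross es] by simp
  have lenC: "length C \<le> 3"
    using lenRC len by simp
  have nodesC: "edge_nodes C \<subseteq> edge_nodes es" and nodesR: "edge_nodes R \<subseteq> edge_nodes es"
    unfolding C_def R_def edge_nodes_orient by (rule edge_nodes_filter)+
  have C: "\<forall>(p, q, g)\<in>set C. p \<notin> S \<and> q \<in> S \<and> 0 \<le> g"
    using nn by (auto simp: C_def cross_def)
  have R: "\<forall>(p, q, g)\<in>set R. (p \<in> S \<longleftrightarrow> q \<in> S) \<and> 0 \<le> g"
    using nn by (auto simp: R_def cross_def)
  have R_shift: "energy R (\<lambda>z. if z \<in> S then u z + d else u z) \<phi> = energy R u \<phi>" for u d \<phi>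
    using R by (induction R) (auto simp: algebra_simps)
  \<comment> \<open>Testing with the indicator function of \<open>S\<close> yields the balance condition.\<close>
  have R_ind: "energy R u (indicat_real S) = 0" for u
    using R by (induction R) (auto simp: indicator_def)
  have C_ind: "energy C u (indicat_real S) = - (\<Sum>(p, q, g)\<leftarrow>C. g * (u p - u q))" for u
    using C by (induction C) (auto simp: indicator_def)
  obtain s t C' where st: "s \<in> S" "t \<notin> S" "{s, t} \<subseteq> {s0, t0} \<union> edge_nodes C"
    and C': "length C' \<le> length C" "\<forall>(p, q, g)\<in>set C'. 0 \<le> g" "edge_nodes C' \<subseteq> edge_nodes C"
    and eq: "\<forall>u \<phi>. (\<Sum>(p, q, g)\<leftarrow>C. g * (u p - u q)) = 0 \<longrightarrow> \<phi> s = \<phi> t \<longrightarrow>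
      energy C' (\<lambda>z. if z \<in> S then u z + (u t - u s) else u z) \<phi> = energy C u \<phi>"
  proof -
    from merge_crossing[OF lenC C S] show ?thesis
      by (elim exE conjE) (rule that)
  qed
  define f where "f = id(s := t)"
  have "has_admittance (map (map_prod f (map_prod f id)) (R @ C')) (f \<circ> a) (f \<circ> b) Y"
    unfolding has_admittance_def
  proof
    fix v
    obtain u where u: "\<And>k. u (a k) - u (b k) = v $ k"
      "\<And>\<phi>. energy es u \<phi> = (\<Sum>k\<in>UNIV. (Y *v v) $ k * (\<phi> (a k) - \<phi> (b k)))"
      using Y unfolding has_admittance_def by metis
    define u' where "u' = (\<lambda>z. if z \<in> S then u z + (u t - u s) else u z)"
    \<comment> \<open>The shifted potential agrees at \<open>s\<close> and \<open>t\<close>, so it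
      survives their identification.\<close>
    have u'f: "u' (f z) = u' z" for z
      using st by (simp add: u'_def f_def)
    have "energy es u (indicat_real S) = 0"
      unfolding u(2) using closed by (simp add: indicator_def)
    then have bal: "(\<Sum>(p, q, g)\<leftarrow>C. g * (u p - u q)) = 0"
      unfolding split R_ind C_ind by simp
    have "energy (map (map_prod f (map_prod f id)) (R @ C')) u' \<phi>
        = (\<Sum>k\<in>UNIV. (Y *v v) $ k * (\<phi> ((f \<circ> a) k) - \<phi> ((f \<circ> b) k)))" for \<phi>
    proof -
      have "energy (map (map_prod f (map_prod f id)) (R @ C')) u' \<phi>
          = energy R u' (\<phi> \<circ> f) + energy C' u' (\<phi> \<circ> f)"
        unfolding energy_map energy_simps by (simp add: comp_def u'f)
      also have "\<dots> = energy R u (\<phi> \<circ> f) + energy C u (\<phi> \<circ> f)"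
        unfolding u'_def R_shift using eq[rule_format, OF bal, of "\<phi> \<circ> f"] st(1,2) by (simp add: f_def)
      also have "\<dots> = (\<Sum>k\<in>UNIV. (Y *v v) $ k * (\<phi> ((f \<circ> a) k) - \<phi> ((f \<circ> b) k)))"
        unfolding split[symmetric] u(2) by simp
      finally show ?thesis .
    qed
    moreover have "u' ((f \<circ> a) k) - u' ((f \<circ> b) k) = v $ k" for k
      using u(1)[of k] closed[of k] by (simp add: u'f) (simp add: u'_def)
    ultimately show "\<exists>u. (\<forall>k. u ((f \<circ> a) k) - u ((f \<circ> b) k) = v $ k) \<and>
        (\<forall>\<phi>. energy (map (map_prod f (map_prod f id)) (R @ C')) u \<phi>
          = (\<Sum>k\<in>UNIV. (Y *v v) $ k * (\<phi> ((f \<circ> a) k) - \<phi> ((f \<circ> b) k))))"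
      by blast
  qed
  moreover have "edge_nodes (map (map_prod f (map_prod f id)) (R @ C')) \<subseteq> f ` edge_nodes es"
    unfolding edge_nodes_map using C'(3) nodesC nodesR by auto
  moreover have "length (map (map_prod f (map_prod f id)) (R @ C')) \<le> length es"
    using C'(1) lenRC by simp
  moreover have "\<forall>(p, q, g)\<in>set (map (map_prod f (map_prod f id)) (R @ C')). 0 \<le> g"
    using C'(2) R by (simp add: ball_Un split_beta)
  moreover have "{s, t} \<subseteq> {s0, t0} \<union> edge_nodes es"
    using st(3) nodesC by blast
  ultimately show ?thesis
    using st(1,2) unfolding f_def
    by - (rule exI[of _ s], rule exI[of _ t], rule exI, intro conjI; assumption)
qed

text \<open>Induction on the number of nodes that carry elements or ports. A merge is possible at a
  node that is no terminal, and at the terminal pair of a port disjoint from the other two; if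
  neither exists, the claim holds already.\<close>

lemma reduce_admittance:
  fixes es :: "('v \<times> 'v \<times> real) list" and a b :: "3 \<Rightarrow> 'v"
  assumes "has_admittance es a b Y" "length es \<le> 3" "\<forall>(p, q, g)\<in>set es. 0 \<le> g"
  shows "\<exists>(es' :: ('v \<times> 'v \<times> real) list) a' b'. has_admittance es' a' b' Y \<and> length es' \<le> 3 \<and>
    (\<forall>(p, q, g)\<in>set es'. 0 \<le> g) \<and> edge_nodes es' \<subseteq> range a' \<union> range b' \<and>
    (\<forall>k. \<exists>j. j \<noteq> k \<and> {a' j, b' j} \<inter> {a' k, b' k} \<noteq> {})"
  using assms
proof (induction "card (edge_nodes es \<union> range a \<union> range b)" arbitrary: es a b rule: less_induct)
  case less
  let ?V = "\<lambda>es a b. edge_nodes es \<union> range a \<union> range b"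
  \<comment> \<open>One merge followed by the induction hypothesis.\<close>
  have *: ?case if closed: "\<And>k. a k \<in> S \<longleftrightarrow> b k \<in> S" and S: "S \<subseteq> {x, y}" "s0 \<in> S" "t0 \<notin> S"
    and V: "S \<subseteq> ?V es a b" "t0 \<in> ?V es a b" for S x y s0 t0
  proof -
    obtain s t es' where st: "s \<in> S" "t \<notin> S" "{s, t} \<subseteq> {s0, t0} \<union> edge_nodes es"
      and es': "length es' \<le> length es" "\<forall>(p, q, g)\<in>set es'. 0 \<le> g"
      "edge_nodes es' \<subseteq> id(s := t) ` edge_nodes es"
      "has_admittance es' (id(s := t) \<circ> a) (id(s := t) \<circ> b) Y"
    proof -
      from merge_admittance[OF less.prems closed S] show ?thesis
        by (elim exE conjE) (rule that)
    qed
    have "?V es' (id(s := t) \<circ> a) (id(s := t) \<circ> b) \<subseteq> id(s := t) ` ?V es a b"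
      using es'(3) by auto
    \<comment> \<open>The identification sends \<open>s\<close> to \<open>t\<close>, which is
      already present, so the node count drops.\<close>
    also have "\<dots> \<subseteq> ?V es a b - {s}"
    proof -
      have "s0 \<in> ?V es a b" using S V by blast
      then have "{s, t} \<subseteq> ?V es a b" "s \<noteq> t" using st V(2) by auto
      then show ?thesis by (intro subsetI) (auto simp del: Un_iff)
    qed
    finally have "?V es' (id(s := t) \<circ> a) (id(s := t) \<circ> b) \<subseteq> ?V es a b - {s}" .
    moreover have "s \<in> ?V es a b"
      using st(1) V by auto
    moreover have "finite (?V es a b)"
      by simp
    ultimately have "card (?V es' (id(s := t) \<circ> a) (id(s := t) \<circ> b)) < card (?V es a b)"
      by (metis card_Diff1_less card_mono finite_Diff le_less_trans)
    from less.hyps[OF this es'(4) _ es'(2)] es'(1) less.prems(2) show ?thesis by simp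
  qed
  show ?case
  proof (rule ccontr)
    assume neg: "\<not> ?case"
    have nodes: "edge_nodes es \<subseteq> range a \<union> range b"
    proof (rule subsetI, rule ccontr)
      fix x assume x: "x \<in> edge_nodes es" "x \<notin> range a \<union> range b"
      then have "a k \<noteq> x" "b k \<noteq> x" for k by auto
      then have ?case
        using x by (intro *[of "{x}" x x x "a 1"]) auto
      with neg show False by contradiction
    qed
    have "\<exists>j. j \<noteq> k \<and> {a j, b j} \<inter> {a k, b k} \<noteq> {}" for k
    proof (rule ccontr)
      assume iso: "\<not> (\<exists>j. j \<noteq> k \<and> {a j, b j} \<inter> {a k, b k} \<noteq> {})"
      obtain j :: 3 where j: "j \<noteq> k"
        using that[of 1] that[of 2] by (cases "k = 1") auto
      have "a i \<in> {a k, b k} \<longleftrightarrow> b i \<in> {a k, b k}" for i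
        using iso by (cases "i = k") blast+
      then have ?case
        using iso j by (intro *[of "{a k, b k}" "a k" "b k" "a k" "a j"]) blast+
      with neg show False by contradiction
    qed
    with neg nodes less.prems show False by blast
  qed
qed

section \<open>From networks to the variational form\<close>

text \<open>One direction multiplies the current law at \<open>x\<close> by \<open>\<phi> x\<close>
  and sums over the nodes; the other tests with point masses. Ohm's law then eliminates the element
  currents.\<close>

lemma compatible_iff:
  fixes N :: "('v, 'e, 'n::finite) network"
  assumes N: "fin_digraph (augmented_graph N)"
  shows "compatible N v i \<longleftrightarrow>
    (\<exists>u. (\<forall>k. v $ k = u (fst (port N k)) - u (snd (port N k))) \<and>
      (\<forall>\<phi>. (\<Sum>e\<in>elements N. conductance N e * (u (fst (ends N e)) - u (snd (ends N e)))
            * (\<phi> (fst (ends N e)) - \<phi> (snd (ends N e))))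
          = (\<Sum>k\<in>UNIV. i $ k * (\<phi> (fst (port N k)) - \<phi> (snd (port N k))))))"
    (is "_ \<longleftrightarrow> (\<exists>u. ?port u \<and> (\<forall>\<phi>. ?weak u \<phi>))")
proof -
  interpret fin_digraph "augmented_graph N" by (rule N)
  have fin: "finite (elements N)" "finite (nodes N)"
    using finite_arcs finite_verts by (simp_all add: augmented_graph_def finite_Plus_iff)
  have ends: "fst (ends N e) \<in> nodes N" "snd (ends N e) \<in> nodes N" if "e \<in> elements N" for e
    using tail_in_verts[of "Inl e"] head_in_verts[of "Inl e"] that by (auto simp: augmented_graph_def)
  have ports: "fst (port N k) \<in> nodes N" "snd (port N k) \<in> nodes N" for k
    using tail_in_verts[of "Inr k"] head_in_verts[of "Inr k"] by (auto simp: augmented_graph_def)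
  define kcl where "kcl c x \<longleftrightarrow>
      (\<Sum>e | e \<in> elements N \<and> fst (ends N e) = x. c e)
        - (\<Sum>e | e \<in> elements N \<and> snd (ends N e) = x. c e)
      = (\<Sum>k | fst (port N k) = x. i $ k) - (\<Sum>k | snd (port N k) = x. i $ k)" for c x
  have kcl_weak: "(\<forall>x\<in>nodes N. kcl c x) \<longleftrightarrow>
      (\<forall>\<phi>. (\<Sum>e\<in>elements N. c e * (\<phi> (fst (ends N e)) - \<phi> (snd (ends N e))))
        = (\<Sum>k\<in>UNIV. i $ k * (\<phi> (fst (port N k)) - \<phi> (snd (port N k)))))" for c
  proof
    assume kcl: "\<forall>x\<in>nodes N. kcl c x"
    show "\<forall>\<phi>. (\<Sum>e\<in>elements N. c e * (\<phi> (fst (ends N e)) - \<phi> (snd (ends N e))))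
        = (\<Sum>k\<in>UNIV. i $ k * (\<phi> (fst (port N k)) - \<phi> (snd (port N k))))"
    proof
      fix \<phi> :: "'v \<Rightarrow> real"
      have E: "(\<Sum>x\<in>nodes N. \<phi> x * (\<Sum>e | e \<in> elements N \<and> f e = x. c e)) = (\<Sum>e\<in>elements N. c e * \<phi> (f e))"
        if "\<And>e. e \<in> elements N \<Longrightarrow> f e \<in> nodes N" for f
      proof -
        have "(\<Sum>x\<in>nodes N. \<phi> x * (\<Sum>e | e \<in> elements N \<and> f e = x. c e))
            = (\<Sum>x\<in>nodes N. \<Sum>e | e \<in> elements N \<and> f e = x. c e * \<phi> (f e))"
          by (auto simp: sum_distrib_left mult.commute intro!: sum.cong)
        also have "\<dots> = (\<Sum>e\<in>elements N. c e * \<phi> (f e))"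
          using fin that by (intro sum.group) auto
        finally show ?thesis .
      qed
      have P: "(\<Sum>x\<in>nodes N. \<phi> x * (\<Sum>k | f k = x. i $ k)) = (\<Sum>k\<in>UNIV. i $ k * \<phi> (f k))"
        if "\<And>k. f k \<in> nodes N" for f
      proof -
        have "(\<Sum>x\<in>nodes N. \<phi> x * (\<Sum>k | f k = x. i $ k))
            = (\<Sum>x\<in>nodes N. \<Sum>k | k \<in> UNIV \<and> f k = x. i $ k * \<phi> (f k))"
          by (auto simp: sum_distrib_left mult.commute intro!: sum.cong)
        also have "\<dots> = (\<Sum>k\<in>UNIV. i $ k * \<phi> (f k))"
          using fin that by (intro sum.group) auto
        finally show ?thesis .
      qed
      have "(\<Sum>e\<in>elements N. c e * (\<phi> (fst (ends N e)) - \<phi> (snd (ends N e))))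
          = (\<Sum>x\<in>nodes N. \<phi> x * ((\<Sum>e | e \<in> elements N \<and> fst (ends N e) = x. c e)
              - (\<Sum>e | e \<in> elements N \<and> snd (ends N e) = x. c e)))"
        using E[of "\<lambda>e. fst (ends N e)"] E[of "\<lambda>e. snd (ends N e)"] ends
        by (simp add: right_diff_distrib sum_subtractf)
      also have "\<dots> = (\<Sum>x\<in>nodes N. \<phi> x * ((\<Sum>k | fst (port N k) = x. i $ k)
          - (\<Sum>k | snd (port N k) = x. i $ k)))"
        using kcl by (intro sum.cong) (auto simp: kcl_def)
      also have "\<dots> = (\<Sum>k\<in>UNIV. i $ k * (\<phi> (fst (port N k)) - \<phi> (snd (port N k))))"
        using P[of "\<lambda>k. fst (port N k)"] P[of "\<lambda>k. snd (port N k)"] ports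
        by (simp add: right_diff_distrib sum_subtractf)
      finally show "(\<Sum>e\<in>elements N. c e * (\<phi> (fst (ends N e)) - \<phi> (snd (ends N e))))
        = (\<Sum>k\<in>UNIV. i $ k * (\<phi> (fst (port N k)) - \<phi> (snd (port N k))))" .
    qed
  next
    assume weak: "\<forall>\<phi>. (\<Sum>e\<in>elements N. c e * (\<phi> (fst (ends N e)) - \<phi> (snd (ends N e))))
        = (\<Sum>k\<in>UNIV. i $ k * (\<phi> (fst (port N k)) - \<phi> (snd (port N k))))"
    have "kcl c x" for x
      using weak[rule_format, of "\<lambda>z. of_bool (z = x)"] fin
      by (simp add: right_diff_distrib sum_subtractf Int_def kcl_def)
    then show "\<forall>x\<in>nodes N. kcl c x" ..
  qed
  have "compatible N v i \<longleftrightarrow> (\<exists>u. ?port u \<and> (\<exists>c.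
      (\<forall>e\<in>elements N. c e = conductance N e * (u (fst (ends N e)) - u (snd (ends N e)))) \<and>
      (\<forall>\<phi>. (\<Sum>e\<in>elements N. c e * (\<phi> (fst (ends N e)) - \<phi> (snd (ends N e))))
        = (\<Sum>k\<in>UNIV. i $ k * (\<phi> (fst (port N k)) - \<phi> (snd (port N k)))))))"
    unfolding compatible_def kcl_weak[symmetric] kcl_def by (simp only: ex_simps)
  also have "\<dots> \<longleftrightarrow> (\<exists>u. ?port u \<and> (\<forall>\<phi>. ?weak u \<phi>))"
  proof (intro ex_cong1 conj_cong refl iffI)
    fix u
    assume "\<exists>c. (\<forall>e\<in>elements N. c e = conductance N e * (u (fst (ends N e)) - u (snd (ends N e)))) \<and>
      (\<forall>\<phi>. (\<Sum>e\<in>elements N. c e * (\<phi> (fst (ends N e)) - \<phi> (snd (ends N e))))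
        = (\<Sum>k\<in>UNIV. i $ k * (\<phi> (fst (port N k)) - \<phi> (snd (port N k)))))"
    then show "\<forall>\<phi>. ?weak u \<phi>" by auto
  next
    fix u assume "\<forall>\<phi>. ?weak u \<phi>"
    then show "\<exists>c. (\<forall>e\<in>elements N. c e = conductance N e * (u (fst (ends N e)) - u (snd (ends N e)))) \<and>
      (\<forall>\<phi>. (\<Sum>e\<in>elements N. c e * (\<phi> (fst (ends N e)) - \<phi> (snd (ends N e))))
        = (\<Sum>k\<in>UNIV. i $ k * (\<phi> (fst (port N k)) - \<phi> (snd (port N k)))))"
      by (intro exI[of _ "\<lambda>e. conductance N e * (u (fst (ends N e)) - u (snd (ends N e)))"]) simp
  qed
  finally show ?thesis .
qed

text \<open>Well-definedness supplies a compatible current, which must be \<open>Y *v v\<close>;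
  \<open>compatible_iff\<close> turns this into the variational identity.\<close>

lemma realizes_imp_has_admittance:
  fixes N :: "('v, 'e, 'n::finite) network"
  assumes "realizes N Y"
  obtains es where "has_admittance es (fst \<circ> port N) (snd \<circ> port N) Y"
    "length es = card (elements N)" "\<forall>(p, q, g)\<in>set es. 0 \<le> g"
proof -
  have N: "fin_digraph (augmented_graph N)" and g: "\<forall>e\<in>elements N. conductance N e > 0"
    and ex: "\<exists>i. compatible N v i" and Y: "compatible N v i \<Longrightarrow> i = Y *v v" for v i
    using assms unfolding realizes_def resistive_network_def well_defined_admittance_def by blast+
  interpret fin_digraph "augmented_graph N" by (rule N)
  have "finite (elements N)"
    using finite_arcs by (simp add: augmented_graph_def finite_Plus_iff)
  then obtain l where l: "set l = elements N" "distinct l"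
    using finite_distinct_list by blast
  define es where "es = map (\<lambda>e. (fst (ends N e), snd (ends N e), conductance N e)) l"
  have energy: "energy es u \<phi> = (\<Sum>e\<in>elements N. conductance N e
      * (u (fst (ends N e)) - u (snd (ends N e))) * (\<phi> (fst (ends N e)) - \<phi> (snd (ends N e))))" for u \<phi>
    unfolding energy_def es_def l(1)[symmetric] sum_list_distinct_conv_sum_set[OF l(2), symmetric]
    by (simp add: comp_def)
  have "has_admittance es (fst \<circ> port N) (snd \<circ> port N) Y"
    unfolding has_admittance_def energy
  proof
    fix v
    from ex[of v] Y have "compatible N v (Y *v v)" by metis
    then obtain u where u: "\<forall>k. v $ k = u (fst (port N k)) - u (snd (port N k))"
      "\<forall>\<phi>. (\<Sum>e\<in>elements N. conductance N e * (u (fst (ends N e)) - u (snd (ends N e)))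
            * (\<phi> (fst (ends N e)) - \<phi> (snd (ends N e))))
          = (\<Sum>k\<in>UNIV. (Y *v v) $ k * (\<phi> (fst (port N k)) - \<phi> (snd (port N k))))"
      unfolding compatible_iff[OF N] by (elim exE conjE)
    show "\<exists>u. (\<forall>k. u ((fst \<circ> port N) k) - u ((snd \<circ> port N) k) = v $ k) \<and>
        (\<forall>\<phi>. (\<Sum>e\<in>elements N. conductance N e * (u (fst (ends N e)) - u (snd (ends N e)))
            * (\<phi> (fst (ends N e)) - \<phi> (snd (ends N e))))
          = (\<Sum>k\<in>UNIV. (Y *v v) $ k * (\<phi> ((fst \<circ> port N) k) - \<phi> ((snd \<circ> port N) k))))"
      unfolding comp_apply using u(1) by (intro exI[of _ u] conjI u(2)) simp
  qed
  moreover have "length es = card (elements N)"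
    using l by (simp add: es_def distinct_card[symmetric])
  moreover have "\<forall>(p, q, g)\<in>set es. 0 \<le> g"
    using l(1) g by (auto simp: es_def less_imp_le)
  ultimately show ?thesis using that by blast
qed

section \<open>Port trees on four nodes\<close>

text \<open>Fixes the numbering of the six node pairs to which every later index of \<open>G\<close>
  refers.\<close>

definition k4_ends :: "nat \<Rightarrow> nat \<times> nat" where
  "k4_ends e = [(0, 1), (0, 2), (0, 3), (1, 2), (1, 3), (2, 3)] ! e"

lemma k4_ends_simps [simp]:
  "k4_ends 0 = (0, 1)" "k4_ends (Suc 0) = (0, 2)" "k4_ends 2 = (0, 3)"
  "k4_ends 3 = (1, 2)" "k4_ends 4 = (1, 3)" "k4_ends 5 = (2, 3)"
  by (simp_all add: k4_ends_def)

text \<open>The Dirichlet form of the complete graph on four nodes with conductances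
  \<open>G\<close>; weight 0 stands for an absent element.\<close>

definition k4_form :: "(nat \<Rightarrow> real) \<Rightarrow> (nat \<Rightarrow> real) \<Rightarrow> (nat \<Rightarrow> real) \<Rightarrow> real" where
  "k4_form G h h' = (\<Sum>e<6. G e * (h (fst (k4_ends e)) - h (snd (k4_ends e)))
      * (h' (fst (k4_ends e)) - h' (snd (k4_ends e))))"

lemma k4_form_expand:
  "k4_form G h h' = G 0 * (h 0 - h 1) * (h' 0 - h' 1) + G 1 * (h 0 - h 2) * (h' 0 - h' 2)
    + G 2 * (h 0 - h 3) * (h' 0 - h' 3) + G 3 * (h 1 - h 2) * (h' 1 - h' 2)
    + G 4 * (h 1 - h 3) * (h' 1 - h' 3) + G 5 * (h 2 - h 3) * (h' 2 - h' 3)"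
proof -
  have "{..<6::nat} = {0, 1, 2, 3, 4, 5}" by auto
  then show ?thesis by (simp add: k4_form_def)
qed

lemma k4_form_upd:
  assumes "e < 6"
  shows "k4_form (G(e := G e + g)) h h' = k4_form G h h'
    + g * (h (fst (k4_ends e)) - h (snd (k4_ends e))) * (h' (fst (k4_ends e)) - h' (snd (k4_ends e)))"
proof -
  let ?d = "\<lambda>h i. h (fst (k4_ends i)) - h (snd (k4_ends i))"
  have "k4_form (G(e := G e + g)) h h'
      = (\<Sum>i<6. G i * ?d h i * ?d h' i + (if i = e then g * ?d h e * ?d h' e else 0))"
    unfolding k4_form_def by (intro sum.cong) (auto simp: algebra_simps)
  then show ?thesis
    using assms by (simp add: sum.distrib k4_form_def)
qed

text \<open>Parallel conductances add and loops contribute nothing, so each element makes at most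
  one further weight nonzero.\<close>

lemma energy_k4_form:
  fixes x :: "nat \<Rightarrow> 'v"
  assumes "edge_nodes es \<subseteq> x ` {..<4}" "\<forall>(p, q, g)\<in>set es. 0 \<le> g"
  shows "\<exists>G. (\<forall>e. 0 \<le> G e) \<and> card {e. e < 6 \<and> G e \<noteq> 0} \<le> length es \<and>
    (\<forall>u \<phi>. energy es u \<phi> = k4_form G (u \<circ> x) (\<phi> \<circ> x))"
  using assms
proof (induction es)
  case Nil
  show ?case by (intro exI[of _ "\<lambda>_. 0"]) (simp add: k4_form_def)
next
  case (Cons pqg es)
  obtain p q g where pqg: "pqg = (p, q, g)" by (cases pqg)
  have "edge_nodes es \<subseteq> x ` {..<4}" "\<forall>(p, q, g)\<in>set es. 0 \<le> g"
    using Cons.prems by (simp_all add: pqg)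
  from Cons.IH[OF this] obtain G where G: "\<forall>e. 0 \<le> G e" "card {e. e < 6 \<and> G e \<noteq> 0} \<le> length es"
    "\<forall>u \<phi>. energy es u \<phi> = k4_form G (u \<circ> x) (\<phi> \<circ> x)"
    by (elim exE conjE)
  obtain i j where ij: "i < 4" "j < 4" "p = x i" "q = x j"
    using Cons.prems(1) by (auto simp: pqg)
  show ?case
  proof (cases "i = j")
    case True
    then show ?thesis
      using G ij by (intro exI[of _ G]) (simp add: pqg comp_def)
  next
    case False
    have "\<exists>e<6. k4_ends e = (i, j) \<or> k4_ends e = (j, i)"
    proof -
      have "i \<in> {0, 1, 2, 3}" "j \<in> {0, 1, 2, 3}" using ij(1,2) by auto
      moreover have "P 0 \<or> P 1 \<or> P 2 \<or> P 3 \<or> P 4 \<or> P 5 \<Longrightarrow> \<exists>e<6. P e" for P :: "nat \<Rightarrow> bool"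
        by (elim disjE; rule exI, rule conjI[rotated], assumption, simp)
      ultimately show ?thesis
        using False by (elim insertE emptyE) simp_all
    qed
    then obtain e where e: "e < 6" "k4_ends e = (i, j) \<or> k4_ends e = (j, i)" by blast
    have "0 \<le> g" using Cons.prems(2) by (simp add: pqg)
    then have "\<forall>k. 0 \<le> (G(e := G e + g)) k" using G(1) by simp
    moreover have "card {k. k < 6 \<and> (G(e := G e + g)) k \<noteq> 0} \<le> length (pqg # es)"
    proof -
      have "card {k. k < 6 \<and> (G(e := G e + g)) k \<noteq> 0} \<le> card (insert e {k. k < 6 \<and> G k \<noteq> 0})"
        by (intro card_mono) auto
      also have "\<dots> \<le> Suc (card {k. k < 6 \<and> G k \<noteq> 0})"
        by (simp add: card_insert_if)
      finally show ?thesis using G(2) by simp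
    qed
    moreover have "energy (pqg # es) u \<phi> = k4_form (G(e := G e + g)) (u \<circ> x) (\<phi> \<circ> x)" for u \<phi>
      unfolding k4_form_upd[OF e(1)] pqg energy_simps using G(3) ij e(2)
      by (auto simp: algebra_simps)
    ultimately show ?thesis by blast
  qed
qed

text \<open>
  The matrix of the network with weights \<open>G\<close> whose ports form a star with centre 0 and leaves 1, 2, 3, or a
  path 1 - 0 - 2 - 3 traversed in the port order \<open>a\<close>, \<open>c\<close>, \<open>b\<close>; the signs \<open>s\<close> encode the port orientations.
\<close>

definition star_matrix :: "(nat \<Rightarrow> real) \<Rightarrow> ('n \<Rightarrow> real) \<Rightarrow> real ^ 'n ^ 'n \<Rightarrow> 'n::finite \<Rightarrow> 'n \<Rightarrow> 'n \<Rightarrow> bool" where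
  "star_matrix G s Y a b c \<longleftrightarrow>
    Y $ a $ a = G 0 + G 3 + G 4 \<and> Y $ b $ b = G 1 + G 3 + G 5 \<and> Y $ c $ c = G 2 + G 4 + G 5 \<and>
    Y $ a $ b = - (s a * s b * G 3) \<and> Y $ a $ c = - (s a * s c * G 4) \<and> Y $ b $ c = - (s b * s c * G 5)"

definition path_matrix :: "(nat \<Rightarrow> real) \<Rightarrow> ('n \<Rightarrow> real) \<Rightarrow> real ^ 'n ^ 'n \<Rightarrow> 'n::finite \<Rightarrow> 'n \<Rightarrow> 'n \<Rightarrow> bool" where
  "path_matrix G s Y a c b \<longleftrightarrow>
    Y $ a $ a = G 0 + G 3 + G 4 \<and> Y $ c $ c = G 1 + G 2 + G 3 + G 4 \<and> Y $ b $ b = G 2 + G 4 + G 5 \<and>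
    Y $ a $ c = s a * s c * (G 3 + G 4) \<and> Y $ b $ c = s b * s c * (G 2 + G 4) \<and> Y $ a $ b = s a * s b * G 4"

section \<open>Matrix entries read off from port trees\<close>

lemma k4_form_shift:
  assumes "\<And>i. i < 4 \<Longrightarrow> h i - h 0 = p i" "\<And>i. i < 4 \<Longrightarrow> h' i - h' 0 = p' i"
  shows "k4_form G h h' = k4_form G p p'"
proof -
  have "h i = h 0 + p i" "h' i = h' 0 + p' i" if "i \<in> {1, 2, 3}" for i
    using assms[of i] that by auto
  moreover have "p 0 = 0" "p' 0 = 0"
    using assms[of 0] by auto
  ultimately show ?thesis by (simp add: k4_form_expand)
qed

text \<open>\<open>p v\<close> lists the potentials relative to node 0 that the port voltages
  \<open>v\<close> force along the tree. Entry \<open>(k, j)\<close> arises by driving port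
  \<open>j\<close> with unit voltage and testing with a potential for unit voltage at port
  \<open>k\<close>.\<close>

lemma admittance_entry:
  assumes Y: "has_admittance es a b Y"
    and G: "\<And>u \<phi>. energy es u \<phi> = k4_form G (u \<circ> x) (\<phi> \<circ> x)"
    and p: "\<And>u v i. \<forall>l. u (a l) - u (b l) = v $ l \<Longrightarrow> i < 4 \<Longrightarrow> u (x i) - u (x 0) = p v i"
  shows "Y $ k $ j = k4_form G (p (axis j 1)) (p (axis k 1))"
proof -
  obtain u where u: "\<forall>l. u (a l) - u (b l) = axis j (1::real) $ l"
    "\<forall>\<phi>. energy es u \<phi> = (\<Sum>l\<in>UNIV. (Y *v axis j 1) $ l * (\<phi> (a l) - \<phi> (b l)))"
    using Y unfolding has_admittance_def by blast
  obtain u' where u': "\<forall>l. u' (a l) - u' (b l) = axis k (1::real) $ l"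
    using Y unfolding has_admittance_def by blast
  have "energy es u u' = (\<Sum>l\<in>UNIV. (Y *v axis j 1) $ l * axis k 1 $ l)"
    using u(2) u' by simp
  also have "\<dots> = Y $ k $ j"
    by (subst matrix_vector_mult_basis) (simp add: column_def axis_def if_distrib cong: if_cong)
  finally have "Y $ k $ j = k4_form G (u \<circ> x) (u' \<circ> x)"
    using G by simp
  also have "\<dots> = k4_form G (p (axis j 1)) (p (axis k 1))"
    using p[OF u(1)] p[OF u'] by (intro k4_form_shift) simp_all
  finally show ?thesis .
qed

text \<open>\<open>m\<close> is the terminal opposite to \<open>z\<close>; \<open>s\<close> records
  whether \<open>z\<close> is the negative (1) or the positive (-1) terminal.\<close>

lemma orient_port:
  assumes "z \<in> {a, b}"
  obtains m and s :: real where "{a, b} = {m, z}" "s \<in> {1, -1}"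
    "\<And>u :: 'v \<Rightarrow> real. u a - u b = s * (u m - u z)"
  using assms that[of b "-1"] that[of a 1] by (cases "z = a") auto

lemma lessThan_4: "{..<4::nat} = {0, 1, 2, 3}"
  by auto

lemma three_distinct:
  assumes "distinct [i, c, j :: 3]"
  shows "k = i \<or> k = c \<or> k = j"
  using assms exhaust_3[of i] exhaust_3[of j] exhaust_3[of c] exhaust_3[of k] by auto

text \<open>Relative to the common terminal \<open>z\<close>, each leaf potential is one port
  voltage up to sign.\<close>

lemma star_admittance:
  fixes a b :: "3 \<Rightarrow> 'v"
  assumes Y: "has_admittance es a b Y" and nn: "\<forall>(p, q, g)\<in>set es. 0 \<le> g"
    and nodes: "edge_nodes es \<subseteq> range a \<union> range b" and z: "\<And>k. z \<in> {a k, b k}"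
  shows "\<exists>G s. (\<forall>e. 0 \<le> G e) \<and> card {e. e < 6 \<and> G e \<noteq> 0} \<le> length es \<and>
    (\<forall>k. s k \<in> {1, -1}) \<and> star_matrix G s Y 1 2 3"
proof -
  have "\<exists>m s. {a k, b k} = {m, z} \<and> s \<in> {1, -1::real} \<and> (\<forall>u. u (a k) - u (b k) = s * (u m - u z))" for k
    using orient_port[OF z] by metis
  then obtain m s where m: "\<And>k. {a k, b k} = {m k, z}" and s: "\<And>k. s k \<in> {1, -1::real}"
    and u: "\<And>k u. u (a k) - u (b k) = s k * (u (m k) - u z)"
    by metis
  define x where "x = (\<lambda>i::nat. if i = 0 then z else if i = 1 then m 1 else if i = 2 then m 2 else m 3)"
  have "range a \<union> range b \<subseteq> x ` {..<4}"
  proof -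
    have "{a k, b k} \<subseteq> x ` {..<4}" for k
      unfolding m using exhaust_3[of k] by (auto simp: x_def lessThan_4)
    then show ?thesis by blast
  qed
  with nodes have "edge_nodes es \<subseteq> x ` {..<4}" by blast
  from energy_k4_form[OF this nn] obtain G where G: "\<forall>e. 0 \<le> G e"
    "card {e. e < 6 \<and> G e \<noteq> 0} \<le> length es" "\<forall>u \<phi>. energy es u \<phi> = k4_form G (u \<circ> x) (\<phi> \<circ> x)"
    by (elim exE conjE)
  define p where "p = (\<lambda>(v :: real ^ 3) i::nat. if i = 0 then 0 else if i = 1 then s 1 * v $ 1
    else if i = 2 then s 2 * v $ 2 else s 3 * v $ 3)"
  have ss: "s k * s k = 1" for k using s[of k] by auto
  then have ss': "s k * (s k * t) = t" for k t by (metis mult.assoc mult_1)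
  have p: "u (x i) - u (x 0) = p v i" if "\<forall>l. u (a l) - u (b l) = v $ l" "i < 4" for u :: "'v \<Rightarrow> real" and v i
  proof -
    have "u (m k) - u z = s k * v $ k" for k
      using that(1) u[of u k] ss'[of k] by metis
    then show ?thesis by (simp add: x_def p_def)
  qed
  have entry: "Y $ k $ j = k4_form G (p (axis j 1)) (p (axis k 1))" for k j
    using G(3) p by (intro admittance_entry[OF Y, of G x p]) blast+
  have "star_matrix G s Y 1 2 3"
    unfolding star_matrix_def entry by (simp add: k4_form_expand p_def axis_def ss ss' algebra_simps)
  then show ?thesis using G s by blast
qed

text \<open>The path runs through \<open>m1\<close>, \<open>y\<close>, \<open>z\<close>,
  \<open>m2\<close>, labelled 1, 0, 2, 3; potentials relative to \<open>y\<close> are signed sums of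
  port voltages along it.\<close>

lemma path_admittance:
  fixes a b :: "3 \<Rightarrow> 'v"
  assumes Y: "has_admittance es a b Y" and nn: "\<forall>(p, q, g)\<in>set es. 0 \<le> g"
    and nodes: "edge_nodes es \<subseteq> range a \<union> range b"
    and ijc: "distinct [i, c, j]"
    and path: "{a c, b c} = {y, z}" "y \<in> {a i, b i}" "z \<in> {a j, b j}"
  shows "\<exists>G s. (\<forall>e. 0 \<le> G e) \<and> card {e. e < 6 \<and> G e \<noteq> 0} \<le> length es \<and>
    (\<forall>k. s k \<in> {1, -1}) \<and> path_matrix G s Y i c j"
proof -
  obtain m1 s1 where 1: "{a i, b i} = {m1, y}" "s1 \<in> {1, -1::real}"
    "\<And>u. u (a i) - u (b i) = s1 * (u m1 - u y)"
    using orient_port[OF path(2)] by metis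
  obtain m2 s2 where 2: "{a j, b j} = {m2, z}" "s2 \<in> {1, -1::real}"
    "\<And>u. u (a j) - u (b j) = s2 * (u m2 - u z)"
    using orient_port[OF path(3)] by metis
  obtain s3 where 3: "s3 \<in> {1, -1::real}" "\<And>u. u (a c) - u (b c) = s3 * (u z - u y)"
  proof (cases "a c = z")
    case True
    then have "b c = y" using path(1) by (metis doubleton_eq_iff)
    then show ?thesis using that[of 1] True by simp
  next
    case False
    then have "a c = y" "b c = z" using path(1) by (metis doubleton_eq_iff)+
    then show ?thesis using that[of "-1"] by simp
  qed
  have ne: "i \<noteq> c" "c \<noteq> i" "i \<noteq> j" "j \<noteq> i" "c \<noteq> j" "j \<noteq> c"
    using ijc by auto
  \<comment> \<open>\<open>s1\<close> refers to the rise from \<open>y\<close> to \<open>m1\<close>,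
    against the direction 1 - 0 - 2 - 3, whereas \<open>s3\<close> and \<open>s2\<close> refer to
    rises along it; hence the minus sign.\<close>
  define s where "s = (\<lambda>k. if k = i then - s1 else if k = c then s3 else s2)"
  define x where "x = (\<lambda>k::nat. if k = 0 then y else if k = 1 then m1 else if k = 2 then z else m2)"
  have "range a \<union> range b \<subseteq> x ` {..<4}"
  proof -
    have "{a k, b k} \<subseteq> x ` {..<4}" for k
      using three_distinct[OF ijc, of k] 1(1) 2(1) path(1)
      by (elim disjE) (simp_all add: x_def lessThan_4)
    then show ?thesis by blast
  qed
  with nodes have "edge_nodes es \<subseteq> x ` {..<4}" by blast
  from energy_k4_form[OF this nn] obtain G where G: "\<forall>e. 0 \<le> G e"
    "card {e. e < 6 \<and> G e \<noteq> 0} \<le> length es" "\<forall>u \<phi>. energy es u \<phi> = k4_form G (u \<circ> x) (\<phi> \<circ> x)"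
    by (elim exE conjE)
  define p where "p = (\<lambda>(v :: real ^ 3) k::nat. if k = 0 then 0 else if k = 1 then s1 * v $ i
    else if k = 2 then s3 * v $ c else s3 * v $ c + s2 * v $ j)"
  have ss: "s1 * s1 = 1" "s2 * s2 = 1" "s3 * s3 = 1" using 1(2) 2(2) 3(1) by auto
  then have ss': "s1 * (s1 * t) = t" "s2 * (s2 * t) = t" "s3 * (s3 * t) = t" for t
    by (metis mult.assoc mult_1)+
  have p: "u (x k) - u (x 0) = p v k" if "\<forall>l. u (a l) - u (b l) = v $ l" "k < 4" for u :: "'v \<Rightarrow> real" and v k
  proof -
    have "u m1 - u y = s1 * v $ i" "u m2 - u z = s2 * v $ j" "u z - u y = s3 * v $ c"
      using that(1) 1(3)[of u] 2(3)[of u] 3(2)[of u] ss' by metis+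
    then show ?thesis by (simp add: x_def p_def)
  qed
  have entry: "Y $ k $ j = k4_form G (p (axis j 1)) (p (axis k 1))" for k j
    using G(3) p by (intro admittance_entry[OF Y, of G x p]) blast+
  have "path_matrix G s Y i c j"
    unfolding path_matrix_def entry
    by (simp add: k4_form_expand p_def s_def axis_def ne ss ss' algebra_simps)
  moreover have "\<forall>k. s k \<in> {1, -1}"
    using 1(2) 2(2) 3(1) by (auto simp: s_def)
  ultimately show ?thesis using G by blast
qed

text \<open>Since no port is isolated, some port \<open>c\<close> meets both others. If one node
  serves for both meetings, the ports form a star, otherwise a path with \<open>c\<close> in the
  middle. Three triples suffice because a path can be reversed.\<close>

lemma star_or_path:
  fixes a b :: "3 \<Rightarrow> 'v"
  assumes adj: "\<And>k. \<exists>j. j \<noteq> k \<and> {a j, b j} \<inter> {a k, b k} \<noteq> {}"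
  obtains z where "\<And>k. z \<in> {a k, b k}"
  | i c j y z where "(i, c, j) \<in> {(1, 2, 3), (1, 3, 2), (2, 1, 3)}"
      "{a c, b c} = {y, z}" "y \<in> {a i, b i}" "z \<in> {a j, b j}"
proof -
  note star = that(1) and path = that(2)
  have main: thesis if ijc: "(i, c, j) \<in> {(1, 2, 3), (1, 3, 2), (2, 1, 3)}"
    and adj: "{a i, b i} \<inter> {a c, b c} \<noteq> {}" "{a j, b j} \<inter> {a c, b c} \<noteq> {}" for i c j
  proof -
    obtain y w where y: "y \<in> {a i, b i}" "y \<in> {a c, b c}" and w: "w \<in> {a j, b j}" "w \<in> {a c, b c}"
      using adj by blast
    show thesis
    proof (cases "y = w")
      case True
      have "distinct [i, c, j]" using ijc by auto
      then have "y \<in> {a k, b k}" for k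
        using three_distinct[of i c j k] y w True by auto
      then show thesis by (rule star)
    next
      case False
      then have "{a c, b c} = {y, w}" using y w by auto
      then show thesis using path[OF ijc] y w by blast
    qed
  qed
  define sh where "sh j k \<longleftrightarrow> {a j, b j} \<inter> {a k, b k} \<noteq> {}" for j k
  have sym: "sh j k \<longleftrightarrow> sh k j" for j k unfolding sh_def by blast
  have "\<exists>j. j \<noteq> k \<and> sh j k" for k
    using adj[of k] by (simp only: sh_def)
  from this[of 1] this[of 2] this[of 3]
  have "sh 2 1 \<or> sh 3 1" "sh 1 2 \<or> sh 3 2" "sh 1 3 \<or> sh 2 3"
    using exhaust_3 by metis+
  then consider "sh 1 2" "sh 3 2" | "sh 1 3" "sh 2 3" | "sh 2 1" "sh 3 1"
    using sym by blast
  then show thesis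
    by cases (use main[of 1 2 3] main[of 1 3 2] main[of 2 1 3] in \<open>simp_all add: sh_def\<close>)
qed

section \<open>The sign and weight conditions\<close>

lemma at_least_zero_perm:
  assumes "mset xs = mset ys"
  shows "at_least_zero m xs \<longleftrightarrow> at_least_zero m ys"
  unfolding at_least_zero_def using assms by (metis mset_filter size_mset)

lemma at_least_zero_cong:
  assumes "list_all2 (\<lambda>x y. x = 0 \<longleftrightarrow> y = 0) xs ys"
  shows "at_least_zero m xs \<longleftrightarrow> at_least_zero m ys"
proof -
  have "length (filter (\<lambda>q. q = 0) xs) = length (filter (\<lambda>q. q = 0) ys)"
    using assms by (induction rule: list_all2_induct) auto
  then show ?thesis by (simp add: at_least_zero_def)
qed

text \<open>The slacks \<open>r - l\<close> will be the weights of a path network, so counting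
  equalities becomes counting vanishing weights.\<close>

lemma inequalities_iff_slacks:
  "inequalities_with_equalities m ps \<longleftrightarrow>
    (\<forall>d\<in>set (map (\<lambda>(l, r). r - l) ps). 0 \<le> d) \<and> at_least_zero m (map (\<lambda>(l, r). r - l) ps)"
proof -
  have "length (filter (\<lambda>(l, r). l = r) ps) = length (filter (\<lambda>q. q = 0) (map (\<lambda>(l, r). r - l) ps))"
    by (induction ps) auto
  then show ?thesis
    unfolding inequalities_with_equalities_def at_least_zero_def by auto
qed

text \<open>Both counts are sums of six \<open>of_bool\<close> terms, and complementary terms add up
  to 1, so the counts add up to 6.\<close>

lemma card_nonzero_le_3_iff:
  fixes G :: "nat \<Rightarrow> real"
  shows "card {e. e < 6 \<and> G e \<noteq> 0} \<le> 3 \<longleftrightarrow> at_least_zero 3 [G 0, G 1, G 2, G 3, G 4, G 5]"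
proof -
  have six: "{..<6::nat} = {0, 1, 2, 3, 4, 5}" by auto
  have "{e. e < 6 \<and> G e \<noteq> 0} = {..<6} \<inter> {e. G e \<noteq> 0}" by auto
  also have "card \<dots> = (\<Sum>e<6. of_bool (G e \<noteq> 0))" by simp
  also have "\<dots> = of_bool (G 0 \<noteq> 0) + of_bool (G 1 \<noteq> 0) + of_bool (G 2 \<noteq> 0) + of_bool (G 3 \<noteq> 0)
      + of_bool (G 4 \<noteq> 0) + of_bool (G 5 \<noteq> 0)"
    unfolding six by (simp del: sum_of_bool_eq)
  finally have card: "card {e. e < 6 \<and> G e \<noteq> 0} = \<dots>" .
  have step: "length (filter P (x # xs)) = of_bool (P x) + length (filter P xs)"
    for P and x :: real and xs
    by simp
  have len: "length (filter (\<lambda>q. q = 0) [G 0, G 1, G 2, G 3, G 4, G 5]) = of_bool (G 0 = 0) + (of_bool (G 1 = 0)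
      + (of_bool (G 2 = 0) + (of_bool (G 3 = 0) + (of_bool (G 4 = 0) + of_bool (G 5 = 0)))))"
    unfolding step by simp
  have compl: "of_bool (G e \<noteq> 0) + of_bool (G e = 0) = (1 :: nat)" for e
    by simp
  show ?thesis
    unfolding at_least_zero_def card len
    using compl[of 0] compl[of 1] compl[of 2] compl[of 3] compl[of 4] compl[of 5] by linarith
qed

text \<open>Balance of a signed triangle: a nonnegative product means an even number of negative
  sides, or a zero whose sign is free, so the side signs are products of vertex signs.\<close>

lemma common_signs:
  fixes x y z :: real
  assumes "0 \<le> x * y * z"
  obtains s1 s2 s3 :: real where "s1 \<in> {1, -1}" "s2 \<in> {1, -1}" "s3 \<in> {1, -1}"
    "x = s1 * s2 * \<bar>x\<bar>" "y = s1 * s3 * \<bar>y\<bar>" "z = s2 * s3 * \<bar>z\<bar>"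
proof -
  consider "0 \<le> x" "0 \<le> y" "0 \<le> z" | "0 \<le> x" "y \<le> 0" "z \<le> 0"
    | "x \<le> 0" "0 \<le> y" "z \<le> 0" | "x \<le> 0" "y \<le> 0" "0 \<le> z"
    using assms by (auto simp: zero_le_mult_iff mult_le_0_iff)
  then show ?thesis
  proof cases
    case 1
    then show ?thesis by (intro that[of 1 1 1]) simp_all
  next
    case 2
    then show ?thesis by (intro that[of 1 1 "-1"]) simp_all
  next
    case 3
    then show ?thesis by (intro that[of 1 "-1" 1]) simp_all
  next
    case 4
    then show ?thesis by (intro that[of "-1" 1 1]) simp_all
  qed
qed

text \<open>The default 0 keeps the weights nonnegative at every index, as the quantifier over all
  \<open>e\<close> demands.\<close>

definition weights :: "real list \<Rightarrow> nat \<Rightarrow> real" where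
  "weights gs e = (if e < length gs then gs ! e else 0)"

lemma weights_nonneg: "(\<forall>g\<in>set gs. 0 \<le> g) \<Longrightarrow> 0 \<le> weights gs e"
  by (simp add: weights_def)

lemma abs_sign_mult:
  assumes "s \<in> {1, -1::real}" "t \<in> {1, -1}"
  shows "\<bar>s * t * g\<bar> = \<bar>g\<bar>"
  using assms by (auto simp: abs_mult)

text \<open>Solving for the weights gives \<open>G 3\<close>, \<open>G 4\<close>, \<open>G 5\<close>
  as absolute off-diagonal entries and \<open>G 0\<close>, \<open>G 1\<close>, \<open>G 2\<close> as
  diagonal slacks. Vertex signs square to 1, so the off-diagonal product is
  \<open>- (G 3 * G 4 * G 5)\<close>.\<close>

lemma star_matrix_iff:
  assumes ijc: "distinct [a, b, c]"
  shows "(\<exists>G s. (\<forall>e. 0 \<le> G e) \<and> card {e. e < 6 \<and> G e \<noteq> 0} \<le> 3 \<and>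
      (\<forall>k. s k \<in> {1, -1}) \<and> star_matrix G s Y a b c) \<longleftrightarrow>
    Y $ a $ b * Y $ a $ c * Y $ b $ c \<le> 0 \<and>
    Y $ a $ a - \<bar>Y $ a $ b\<bar> - \<bar>Y $ a $ c\<bar> \<ge> 0 \<and>
    Y $ b $ b - \<bar>Y $ a $ b\<bar> - \<bar>Y $ b $ c\<bar> \<ge> 0 \<and>
    Y $ c $ c - \<bar>Y $ a $ c\<bar> - \<bar>Y $ b $ c\<bar> \<ge> 0 \<and>
    at_least_zero 3
      [Y $ a $ b, Y $ a $ c, Y $ b $ c,
       Y $ a $ a - \<bar>Y $ a $ b\<bar> - \<bar>Y $ a $ c\<bar>,
       Y $ b $ b - \<bar>Y $ a $ b\<bar> - \<bar>Y $ b $ c\<bar>,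
       Y $ c $ c - \<bar>Y $ a $ c\<bar> - \<bar>Y $ b $ c\<bar>]" (is "?L \<longleftrightarrow> ?R")
proof
  assume ?L
  then obtain G s where G: "\<And>e. 0 \<le> G e" "at_least_zero 3 [G 0, G 1, G 2, G 3, G 4, G 5]"
    and s: "\<And>k. s k \<in> {1, -1}" and Y: "star_matrix G s Y a b c"
    unfolding card_nonzero_le_3_iff by blast
  note Y = Y[unfolded star_matrix_def]
  have abs: "\<bar>Y $ a $ b\<bar> = G 3" "\<bar>Y $ a $ c\<bar> = G 4" "\<bar>Y $ b $ c\<bar> = G 5"
    using Y abs_sign_mult[OF s s] G(1) by simp_all
  have zero: "Y $ a $ b = 0 \<longleftrightarrow> G 3 = 0" "Y $ a $ c = 0 \<longleftrightarrow> G 4 = 0" "Y $ b $ c = 0 \<longleftrightarrow> G 5 = 0"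
    using abs by (metis abs_eq_0)+
  have "Y $ a $ b * Y $ a $ c * Y $ b $ c = - ((s a * s a) * (s b * s b) * (s c * s c) * (G 3 * G 4 * G 5))"
    using Y by simp
  also have "\<dots> \<le> 0" using G(1) by (simp add: zero_le_mult_iff)
  finally have "Y $ a $ b * Y $ a $ c * Y $ b $ c \<le> 0" .
  moreover have "at_least_zero 3 [G 3, G 4, G 5, G 0, G 1, G 2]"
    using G(2) by (rule at_least_zero_perm[THEN iffD1, rotated]) simp
  then have "at_least_zero 3 [Y $ a $ b, Y $ a $ c, Y $ b $ c, G 0, G 1, G 2]"
    by (rule at_least_zero_cong[THEN iffD1, rotated]) (simp add: zero)
  ultimately show ?R
    unfolding abs using Y G(1) by simp
next
  assume R: ?R
  \<comment> \<open>Off-diagonal star entries carry an extra minus, so vertex signs are chosen for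
    the negated entries.\<close>
  then have "0 \<le> (- Y $ a $ b) * (- Y $ a $ c) * (- Y $ b $ c)" by simp
  then obtain s1 s2 s3 :: real where s: "s1 \<in> {1, -1}" "s2 \<in> {1, -1}" "s3 \<in> {1, -1}"
    and y: "- Y $ a $ b = s1 * s2 * \<bar>- Y $ a $ b\<bar>" "- Y $ a $ c = s1 * s3 * \<bar>- Y $ a $ c\<bar>"
      "- Y $ b $ c = s2 * s3 * \<bar>- Y $ b $ c\<bar>"
    by (rule common_signs)
  define gs where "gs = [Y $ a $ a - \<bar>Y $ a $ b\<bar> - \<bar>Y $ a $ c\<bar>, Y $ b $ b - \<bar>Y $ a $ b\<bar> - \<bar>Y $ b $ c\<bar>,
    Y $ c $ c - \<bar>Y $ a $ c\<bar> - \<bar>Y $ b $ c\<bar>, \<bar>Y $ a $ b\<bar>, \<bar>Y $ a $ c\<bar>, \<bar>Y $ b $ c\<bar>]"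
  define s where "s = (\<lambda>k. if k = a then s1 else if k = b then s2 else s3)"
  have ne: "a \<noteq> b" "b \<noteq> a" "a \<noteq> c" "c \<noteq> a" "b \<noteq> c" "c \<noteq> b" using ijc by auto
  have "\<forall>e. 0 \<le> weights gs e"
    using R by (intro allI weights_nonneg) (auto simp: gs_def)
  moreover have "card {e. e < 6 \<and> weights gs e \<noteq> 0} \<le> 3"
    unfolding card_nonzero_le_3_iff
  proof (rule at_least_zero_perm[THEN iffD1])
    show "at_least_zero 3 [\<bar>Y $ a $ b\<bar>, \<bar>Y $ a $ c\<bar>, \<bar>Y $ b $ c\<bar>,
       Y $ a $ a - \<bar>Y $ a $ b\<bar> - \<bar>Y $ a $ c\<bar>,
       Y $ b $ b - \<bar>Y $ a $ b\<bar> - \<bar>Y $ b $ c\<bar>,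
       Y $ c $ c - \<bar>Y $ a $ c\<bar> - \<bar>Y $ b $ c\<bar>]"
      using R by (elim conjE at_least_zero_cong[THEN iffD1, rotated]) simp
  qed (simp add: weights_def gs_def)
  moreover have "star_matrix (weights gs) s Y a b c"
    using y ne by (simp add: star_matrix_def weights_def gs_def s_def)
  moreover have "\<forall>k. s k \<in> {1, -1}" using s by (simp add: s_def)
  ultimately show ?L by blast
qed

text \<open>In the order of the list, the six slacks are the weights \<open>G 4\<close>,
  \<open>G 3\<close>, \<open>G 0\<close>, \<open>G 2\<close>, \<open>G 5\<close>,
  \<open>G 1\<close>. The vertex signs cancel in the off-diagonal product and leave nonnegative
  factors.\<close>

lemma path_matrix_iff:
  assumes ijc: "distinct [a, c, b]"
  shows "(\<exists>G s. (\<forall>e. 0 \<le> G e) \<and> card {e. e < 6 \<and> G e \<noteq> 0} \<le> 3 \<and>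
      (\<forall>k. s k \<in> {1, -1}) \<and> path_matrix G s Y a c b) \<longleftrightarrow>
    Y $ a $ c * Y $ a $ b * Y $ b $ c \<ge> 0 \<and>
    inequalities_with_equalities 3
      [(- \<bar>Y $ a $ b\<bar>, 0),
       (\<bar>Y $ a $ b\<bar>, \<bar>Y $ a $ c\<bar>), (\<bar>Y $ a $ c\<bar>, Y $ a $ a),
       (\<bar>Y $ a $ b\<bar>, \<bar>Y $ b $ c\<bar>), (\<bar>Y $ b $ c\<bar>, Y $ b $ b),
       (\<bar>Y $ a $ c\<bar> + \<bar>Y $ b $ c\<bar> - \<bar>Y $ a $ b\<bar>, Y $ c $ c)]" (is "?L \<longleftrightarrow> ?R")
proof
  assume ?L
  then obtain G s where G: "\<And>e. 0 \<le> G e" "at_least_zero 3 [G 0, G 1, G 2, G 3, G 4, G 5]"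
    and s: "\<And>k. s k \<in> {1, -1}" and Y: "path_matrix G s Y a c b"
    unfolding card_nonzero_le_3_iff by blast
  note Y = Y[unfolded path_matrix_def]
  have abs: "\<bar>Y $ a $ b\<bar> = G 4" "\<bar>Y $ a $ c\<bar> = G 3 + G 4" "\<bar>Y $ b $ c\<bar> = G 2 + G 4"
    using Y abs_sign_mult[OF s s] G(1) by simp_all
  have "Y $ a $ c * Y $ a $ b * Y $ b $ c
      = (s a * s a) * (s b * s b) * (s c * s c) * ((G 3 + G 4) * G 4 * (G 2 + G 4))"
    using Y by simp
  also have "\<dots> \<ge> 0" using G(1) by (simp add: zero_le_mult_iff)
  finally have "Y $ a $ c * Y $ a $ b * Y $ b $ c \<ge> 0" .
  moreover have "at_least_zero 3 [G 4, G 3, G 0, G 2, G 5, G 1]"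
    using G(2) by (rule at_least_zero_perm[THEN iffD1, rotated]) simp
  ultimately show ?R
    unfolding abs inequalities_iff_slacks using Y G(1) by (simp add: algebra_simps)
next
  assume R: ?R
  then have "0 \<le> Y $ a $ c * Y $ a $ b * Y $ b $ c" by simp
  then obtain s1 s2 s3 :: real where s: "s1 \<in> {1, -1}" "s2 \<in> {1, -1}" "s3 \<in> {1, -1}"
    and y: "Y $ a $ c = s1 * s2 * \<bar>Y $ a $ c\<bar>" "Y $ a $ b = s1 * s3 * \<bar>Y $ a $ b\<bar>"
      "Y $ b $ c = s2 * s3 * \<bar>Y $ b $ c\<bar>"
    by (rule common_signs)
  define gs where "gs = [Y $ a $ a - \<bar>Y $ a $ c\<bar>, Y $ c $ c - (\<bar>Y $ a $ c\<bar> + \<bar>Y $ b $ c\<bar> - \<bar>Y $ a $ b\<bar>),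
    \<bar>Y $ b $ c\<bar> - \<bar>Y $ a $ b\<bar>, \<bar>Y $ a $ c\<bar> - \<bar>Y $ a $ b\<bar>, \<bar>Y $ a $ b\<bar>, Y $ b $ b - \<bar>Y $ b $ c\<bar>]"
  define s where "s = (\<lambda>k. if k = a then s1 else if k = c then s2 else s3)"
  have ne: "a \<noteq> b" "b \<noteq> a" "a \<noteq> c" "c \<noteq> a" "b \<noteq> c" "c \<noteq> b" using ijc by auto
  have "\<forall>e. 0 \<le> weights gs e"
    using R by (intro allI weights_nonneg) (auto simp: gs_def inequalities_with_equalities_def)
  moreover have "card {e. e < 6 \<and> weights gs e \<noteq> 0} \<le> 3"
    unfolding card_nonzero_le_3_iff
  proof (rule at_least_zero_perm[THEN iffD1])
    show "at_least_zero 3 (map (\<lambda>(l, r). r - l) [(- \<bar>Y $ a $ b\<bar>, 0),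
       (\<bar>Y $ a $ b\<bar>, \<bar>Y $ a $ c\<bar>), (\<bar>Y $ a $ c\<bar>, Y $ a $ a),
       (\<bar>Y $ a $ b\<bar>, \<bar>Y $ b $ c\<bar>), (\<bar>Y $ b $ c\<bar>, Y $ b $ b),
       (\<bar>Y $ a $ c\<bar> + \<bar>Y $ b $ c\<bar> - \<bar>Y $ a $ b\<bar>, Y $ c $ c)])"
      using R unfolding inequalities_iff_slacks by blast
  qed (simp add: weights_def gs_def)
  moreover have "path_matrix (weights gs) s Y a c b"
    using y ne by (simp add: path_matrix_def weights_def gs_def s_def mult.commute)
  moreover have "\<forall>k. s k \<in> {1, -1}" using s by (simp add: s_def)
  ultimately show ?L by blast
qed

section \<open>Networks on four nodes\<close>

text \<open>Connectedness is reachability in the symmetric closure along walks inside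
  \<open>nodes N\<close>. That closure contains every port in both directions, and port steps never
  leave \<open>nodes N\<close>.\<close>

lemma connected_via_ports:
  fixes N :: "('v, 'e, 'n) network"
  assumes "r \<in> nodes N" and wf: "\<And>k. fst (port N k) \<in> nodes N \<and> snd (port N k) \<in> nodes N"
    and reach: "\<And>x. x \<in> nodes N \<Longrightarrow>
      (r, x) \<in> (\<Union>k. {(fst (port N k), snd (port N k)), (snd (port N k), fst (port N k))})\<^sup>*"
  shows "Digraph_Component.connected (augmented_graph N)"
proof -
  let ?R = "\<Union>k. {(fst (port N k), snd (port N k)), (snd (port N k), fst (port N k))}"
  let ?A = "parcs (mk_symmetric (augmented_graph N))"
  have verts: "verts (augmented_graph N) = nodes N"
    by (simp add: augmented_graph_def)
  have sub: "?R \<subseteq> ?A"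
  proof -
    have "{(fst (port N k), snd (port N k)), (snd (port N k), fst (port N k))} \<subseteq> ?A" for k
      unfolding parcs_mk_symmetric by (rule order_trans[OF _ UN_upper[of "Inr k"]]) (auto simp: augmented_graph_def)
    then show ?thesis by blast
  qed
  have "sym ?R" by (rule symI) blast
  then have sym: "sym (?R\<^sup>*)" by (rule sym_rtrancl)
  have on: "(x, y) \<in> rtrancl_on (nodes N) ?A" if "(x, y) \<in> ?R\<^sup>*" "x \<in> nodes N" for x y
    using that
  proof (induction rule: rtrancl_induct)
    case base
    then show ?case by simp
  next
    case (step y z)
    then have "(y, z) \<in> ?A" using sub by blast
    moreover have "z \<in> nodes N"
    proof -
      obtain k where "(y, z) \<in> {(fst (port N k), snd (port N k)), (snd (port N k), fst (port N k))}"
        using step.hyps(2) by blast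
      then show ?thesis using wf[of k] by (simp only: insert_iff empty_iff prod.inject) blast
    qed
    ultimately show ?case using step by (blast intro: rtrancl_on_into_rtrancl_on)
  qed
  have "(x, y) \<in> rtrancl_on (nodes N) ?A" if "x \<in> nodes N" "y \<in> nodes N" for x y
  proof -
    have "(x, r) \<in> ?R\<^sup>*" using reach[OF that(1)] sym by (rule symD[rotated])
    then have "(x, y) \<in> ?R\<^sup>*" using reach[OF that(2)] by (rule rtrancl_trans)
    then show ?thesis using that(1) by (rule on)
  qed
  then show ?thesis
    unfolding Digraph_Component.connected_def strongly_connected_def reachable_def
    using assms(1) by (auto simp: verts)
qed

text \<open>\<open>form\<close> expresses the Dirichlet form through the port voltages as the
  bilinear form of \<open>Y\<close>. \<open>solve\<close> provides potentials for all port voltages,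
  which gives existence of a current and, used for test potentials, its uniqueness.\<close>

lemma realizable_k4:
  fixes p q :: "3 \<Rightarrow> nat" and Y :: "real ^ 3 ^ 3"
  assumes G: "\<And>e. 0 \<le> G e" "card {e. e < 6 \<and> G e \<noteq> 0} \<le> 3"
    and s: "\<And>k. s k \<in> {1, -1::real}"
    and pq: "\<And>k. p k < 4 \<and> q k < 4 \<and> p k \<noteq> q k"
    and reach: "\<And>x. x < 4 \<Longrightarrow> (0, x) \<in> (\<Union>k. {(p k, q k), (q k, p k)})\<^sup>*"
    and solve: "\<And>w :: 3 \<Rightarrow> real. \<exists>h. \<forall>k. h (p k) - h (q k) = w k"
    and form: "\<And>h h'. k4_form G h h' =
      (\<Sum>k\<in>UNIV. (\<Sum>l\<in>UNIV. Y $ k $ l * (s l * (h (p l) - h (q l)))) * (s k * (h' (p k) - h' (q k))))"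
  shows "realizable_with_at_most 3 Y"
proof -
  \<comment> \<open>Only nonzero weights become elements, so conductances are positive; sign -1 is
    realized by swapping the terminals of a port.\<close>
  define N :: "(nat, nat, 3) network" where "N = \<lparr>nodes = {..<4}, elements = {e. e < 6 \<and> G e \<noteq> 0},
    ends = k4_ends, conductance = G, port = (\<lambda>k. if s k = 1 then (p k, q k) else (q k, p k))\<rparr>"
  have N: "nodes N = {..<4}" "elements N = {e. e < 6 \<and> G e \<noteq> 0}" "ends N = k4_ends"
    "conductance N = G" "port N k = (if s k = 1 then (p k, q k) else (q k, p k))" for k
    by (simp_all add: N_def)
  have ends: "fst (k4_ends e) < 4 \<and> snd (k4_ends e) < 4 \<and> fst (k4_ends e) \<noteq> snd (k4_ends e)"
    if "e < 6" for e
  proof -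
    have "e \<in> {0, 1, 2, 3, 4, 5}" using that by auto
    then show ?thesis by (elim insertE emptyE) simp_all
  qed
  have pq': "q k \<noteq> p k" for k using pq[of k] by simp
  have drop: "u (fst (port N k)) - u (snd (port N k)) = s k * (u (p k) - u (q k))" for u k
    using s[of k] by (auto simp: N)
  have ss: "s k * (s k * t) = t" for k t using s[of k] by auto
  have solve': "\<exists>h. \<forall>k. s k * (h (p k) - h (q k)) = v k" for v
  proof -
    obtain h where "\<forall>k. h (p k) - h (q k) = s k * v k"
      using solve[of "\<lambda>k. s k * v k"] by blast
    then show ?thesis by (intro exI[of _ h]) (simp add: ss)
  qed
  have fin: "fin_digraph (augmented_graph N)"
    by unfold_locales (use ends pq pq' in \<open>auto simp: augmented_graph_def N split: sum.splits\<close>)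
  moreover have "loopfree_digraph (augmented_graph N)"
    by unfold_locales (use ends pq pq' in \<open>auto simp: augmented_graph_def N split: sum.splits\<close>)
  moreover have "Digraph_Component.connected (augmented_graph N)"
  proof (rule connected_via_ports)
    have "{(fst (port N k), snd (port N k)), (snd (port N k), fst (port N k))} = {(p k, q k), (q k, p k)}" for k
      by (auto simp: N)
    then show "(0, x) \<in> (\<Union>k. {(fst (port N k), snd (port N k)), (snd (port N k), fst (port N k))})\<^sup>*"
      if "x \<in> nodes N" for x
      using reach[of x] that by (simp add: N(1))
  qed (use pq in \<open>auto simp: N\<close>)
  moreover have "\<forall>e\<in>elements N. 0 < conductance N e"
    using G(1) by (auto simp: N less_le)
  ultimately have net: "resistive_network N"
    unfolding resistive_network_def by blast
  have elements_sum: "(\<Sum>e\<in>elements N. conductance N e * (u (fst (ends N e)) - u (snd (ends N e)))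
      * (\<phi> (fst (ends N e)) - \<phi> (snd (ends N e)))) = k4_form G u \<phi>" for u \<phi>
    unfolding k4_form_def N by (intro sum.mono_neutral_left) auto
  have compat: "compatible N v i \<longleftrightarrow> i = Y *v v" for v i
  proof -
    have form': "k4_form G u \<phi> = (\<Sum>k\<in>UNIV. (Y *v v) $ k * (s k * (\<phi> (p k) - \<phi> (q k))))"
      if "\<forall>k. v $ k = s k * (u (p k) - u (q k))" for u \<phi>
      unfolding form using that by (simp add: matrix_vector_mult_def)
    have "compatible N v i \<longleftrightarrow> (\<exists>u. (\<forall>k. v $ k = s k * (u (p k) - u (q k))) \<and>
        (\<forall>\<phi>. (\<Sum>k\<in>UNIV. (Y *v v) $ k * (s k * (\<phi> (p k) - \<phi> (q k))))
          = (\<Sum>k\<in>UNIV. i $ k * (s k * (\<phi> (p k) - \<phi> (q k))))))"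
      unfolding compatible_iff[OF fin] elements_sum drop
    proof (intro ex_cong1 conj_cong refl)
      fix u assume v: "\<forall>k. v $ k = s k * (u (p k) - u (q k))"
      show "(\<forall>\<phi>. k4_form G u \<phi> = (\<Sum>k\<in>UNIV. i $ k * (s k * (\<phi> (p k) - \<phi> (q k))))) \<longleftrightarrow>
        (\<forall>\<phi>. (\<Sum>k\<in>UNIV. (Y *v v) $ k * (s k * (\<phi> (p k) - \<phi> (q k))))
          = (\<Sum>k\<in>UNIV. i $ k * (s k * (\<phi> (p k) - \<phi> (q k)))))"
        by (simp only: form'[OF v])
    qed
    also have "\<dots> \<longleftrightarrow> i = Y *v v"
    proof
      assume "i = Y *v v"
      moreover obtain u where "\<forall>k. s k * (u (p k) - u (q k)) = v $ k" using solve' by blast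
      ultimately show "\<exists>u. (\<forall>k. v $ k = s k * (u (p k) - u (q k))) \<and>
        (\<forall>\<phi>. (\<Sum>k\<in>UNIV. (Y *v v) $ k * (s k * (\<phi> (p k) - \<phi> (q k))))
          = (\<Sum>k\<in>UNIV. i $ k * (s k * (\<phi> (p k) - \<phi> (q k)))))"
        by (intro exI[of _ u]) simp
    next
      assume "\<exists>u. (\<forall>k. v $ k = s k * (u (p k) - u (q k))) \<and>
        (\<forall>\<phi>. (\<Sum>k\<in>UNIV. (Y *v v) $ k * (s k * (\<phi> (p k) - \<phi> (q k))))
          = (\<Sum>k\<in>UNIV. i $ k * (s k * (\<phi> (p k) - \<phi> (q k)))))"
      then have eq: "(\<Sum>k\<in>UNIV. (Y *v v) $ k * (s k * (\<phi> (p k) - \<phi> (q k))))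
          = (\<Sum>k\<in>UNIV. i $ k * (s k * (\<phi> (p k) - \<phi> (q k))))" for \<phi> by blast
      \<comment> \<open>Testing with a potential whose port voltages are the difference of the two
        currents makes the squared norm of that difference vanish.\<close>
      obtain \<phi> where \<phi>: "\<forall>k. s k * (\<phi> (p k) - \<phi> (q k)) = (i - Y *v v) $ k" using solve' by blast
      have "(Y *v v) \<bullet> (i - Y *v v) = i \<bullet> (i - Y *v v)"
        using eq[of \<phi>] by (simp only: \<phi>[rule_format] inner_vec_def inner_real_def)
      then have "(i - Y *v v) \<bullet> (i - Y *v v) = 0"
        unfolding inner_diff_left[of i "Y *v v"] by simp
      then show "i = Y *v v" by simp
    qed
    finally show ?thesis .
  qed
  have "realizes N Y"
    unfolding realizes_def well_defined_admittance_def using net by (simp add: compat Ex1_def)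
  moreover have "card (elements N) \<le> 3" using G(2) by (simp add: N)
  ultimately show ?thesis unfolding realizable_with_at_most_def by blast
qed

section \<open>Realizing star and path matrices\<close>

lemma star_matrix_realizable:
  fixes Y :: "real ^ 3 ^ 3"
  assumes sym: "\<And>k l. Y $ k $ l = Y $ l $ k"
    and G: "\<And>e. 0 \<le> G e" "card {e. e < 6 \<and> G e \<noteq> 0} \<le> 3"
    and s: "\<And>k. s k \<in> {1, -1::real}" and Y: "star_matrix G s Y 1 2 3"
  shows "realizable_with_at_most 3 Y"
proof -
  define p :: "3 \<Rightarrow> nat" where "p k = (if k = 1 then 1 else if k = 2 then 2 else 3)" for k
  have p: "p 1 = 1" "p 2 = 2" "p 3 = 3" by (simp_all add: p_def)
  have ss: "s k * s k = 1" "s k * (s k * t) = t" for k t using s[of k] by auto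
  have sym: "Y $ 2 $ 1 = Y $ 1 $ 2" "Y $ 3 $ 1 = Y $ 1 $ 3" "Y $ 3 $ 2 = Y $ 2 $ 3"
    by (rule sym)+
  show ?thesis
  proof (rule realizable_k4[OF G s, of p "\<lambda>_. 0"])
    fix k show "p k < 4 \<and> 0 < (4::nat) \<and> p k \<noteq> 0" by (simp add: p_def)
  next
    fix x :: nat assume "x < 4"
    then have "x = 0 \<or> x = p 1 \<or> x = p 2 \<or> x = p 3" unfolding p by linarith
    then show "(0, x) \<in> (\<Union>k. {(p k, 0), (0, p k)})\<^sup>*" by blast
  next
    fix w :: "3 \<Rightarrow> real"
    show "\<exists>h. \<forall>k. h (p k) - h 0 = w k"
      by (rule exI[of _ "\<lambda>x. if x = 1 then w 1 else if x = 2 then w 2 else if x = 3 then w 3 else 0"])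
        (simp add: forall_3 p)
  next
    fix h h'
    show "k4_form G h h' = (\<Sum>k\<in>UNIV. (\<Sum>l\<in>UNIV. Y $ k $ l * (s l * (h (p l) - h 0))) * (s k * (h' (p k) - h' 0)))"
      using Y unfolding star_matrix_def sum_3 p sym
      by (simp add: k4_form_expand ss algebra_simps)
  qed
qed

lemma path_matrix_realizable:
  fixes Y :: "real ^ 3 ^ 3"
  assumes sym: "\<And>k l. Y $ k $ l = Y $ l $ k"
    and G: "\<And>e. 0 \<le> G e" "card {e. e < 6 \<and> G e \<noteq> 0} \<le> 3"
    and s: "\<And>k. s k \<in> {1, -1::real}" and Y: "path_matrix G s Y i c j" and ijc: "distinct [i, c, j]"
  shows "realizable_with_at_most 3 Y"
proof -
  \<comment> \<open>Each port drop from \<open>p k\<close> to \<open>q k\<close> is the rise along 1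
    - 0 - 2 - 3; for this common direction the off-diagonal entries of \<open>path_matrix\<close>
    carry no minus sign.\<close>
  define p :: "3 \<Rightarrow> nat" where "p k = (if k = i then 0 else if k = c then 2 else 3)" for k
  define q :: "3 \<Rightarrow> nat" where "q k = (if k = i then 1 else if k = c then 0 else 2)" for k
  have ne: "i \<noteq> c" "c \<noteq> i" "i \<noteq> j" "j \<noteq> i" "c \<noteq> j" "j \<noteq> c"
    using ijc by auto
  have pq: "p i = 0" "p c = 2" "p j = 3" "q i = 1" "q c = 0" "q j = 2" by (simp_all add: p_def q_def ne)
  have ss: "s k * s k = 1" "s k * (s k * t) = t" for k t using s[of k] by auto
  have sym: "Y $ c $ i = Y $ i $ c" "Y $ j $ i = Y $ i $ j" "Y $ c $ j = Y $ j $ c"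
    by (rule sym)+
  have univ: "UNIV = {i, c, j}" using three_distinct[OF ijc] by auto
  show ?thesis
  proof (rule realizable_k4[OF G s, of p q])
    fix k show "p k < 4 \<and> q k < 4 \<and> p k \<noteq> q k" by (simp add: p_def q_def)
  next
    fix x :: nat assume "x < 4"
    let ?R = "\<Union>k. {(p k, q k), (q k, p k)}"
    have R: "(0, 1) \<in> ?R" "(0, 2) \<in> ?R" "(2, 3) \<in> ?R"
      using pq by (metis (no_types, lifting) UN_I UNIV_I insertCI)+
    have "(0, 1) \<in> ?R\<^sup>*" "(0, 2) \<in> ?R\<^sup>*" "(0, 3) \<in> ?R\<^sup>*"
      using R by (meson r_into_rtrancl rtrancl_trans)+
    moreover have "x = 0 \<or> x = 1 \<or> x = 2 \<or> x = 3" using \<open>x < 4\<close> by linarith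
    ultimately show "(0, x) \<in> ?R\<^sup>*"
      by (elim disjE) (simp_all only: rtrancl.rtrancl_refl)
  next
    fix w :: "3 \<Rightarrow> real"
    \<comment> \<open>The potential sums \<open>w\<close> along the path, starting with 0 at node
      0.\<close>
    have "h (p k) - h (q k) = w k"
      if "h = (\<lambda>x. if x = 0 then 0 else if x = 1 then - w i else if x = 2 then w c else w c + w j)" for h k
      using three_distinct[OF ijc, of k] by (elim disjE) (simp_all add: pq that)
    then show "\<exists>h. \<forall>k. h (p k) - h (q k) = w k" by blast
  next
    fix h h'
    show "k4_form G h h' = (\<Sum>k\<in>UNIV. (\<Sum>l\<in>UNIV. Y $ k $ l * (s l * (h (p l) - h (q l)))) * (s k * (h' (p k) - h' (q k))))"
      using Y unfolding path_matrix_def univ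
      by (simp add: ne pq sym k4_form_expand ss algebra_simps)
  qed
qed

text \<open>Necessity passes to a reduced network, whose ports form a star or a path. For
  sufficiency, symmetry supplies the entries that \<open>star_matrix\<close> and
  \<open>path_matrix\<close> do not mention.\<close>

lemma realizable_with_at_most_3_iff:
  fixes Y :: "real ^ 3 ^ 3"
  assumes sym: "\<And>k l. Y $ k $ l = Y $ l $ k"
  shows "realizable_with_at_most 3 Y \<longleftrightarrow>
    (\<exists>G s. (\<forall>e. 0 \<le> G e) \<and> card {e. e < 6 \<and> G e \<noteq> 0} \<le> 3 \<and> (\<forall>k. s k \<in> {1, -1}) \<and>
      star_matrix G s Y 1 2 3) \<or>
    (\<exists>(i, c, j)\<in>{(1, 2, 3), (1, 3, 2), (2, 1, 3)}.
      \<exists>G s. (\<forall>e. 0 \<le> G e) \<and> card {e. e < 6 \<and> G e \<noteq> 0} \<le> 3 \<and> (\<forall>k. s k \<in> {1, -1}) \<and>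
        path_matrix G s Y i c j)" (is "_ \<longleftrightarrow> ?star \<or> ?path")
proof
  assume "realizable_with_at_most 3 Y"
  then obtain N :: "(nat, nat, 3) network" where "realizes N Y" and N: "card (elements N) \<le> 3"
    unfolding realizable_with_at_most_def by blast
  from this(1) obtain es where es: "has_admittance es (fst \<circ> port N) (snd \<circ> port N) Y"
    "length es = card (elements N)" "\<forall>(p, q, g)\<in>set es. 0 \<le> g"
    by (rule realizes_imp_has_admittance)
  have "length es \<le> 3" using es(2) N by simp
  from reduce_admittance[OF es(1) this es(3)]
  obtain es' :: "(nat \<times> nat \<times> real) list" and a b where Y: "has_admittance es' a b Y"
    and len: "length es' \<le> 3" and nn: "\<forall>(p, q, g)\<in>set es'. 0 \<le> g"
    and nodes: "edge_nodes es' \<subseteq> range a \<union> range b"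
    and adj: "\<forall>k. \<exists>j. j \<noteq> k \<and> {a j, b j} \<inter> {a k, b k} \<noteq> {}"
    by (elim exE conjE)
  from adj[rule_format] show "?star \<or> ?path"
  proof (cases rule: star_or_path)
    case (1 z)
    from star_admittance[OF Y nn nodes 1] len have ?star
      by (meson order_trans)
    then show ?thesis ..
  next
    case (2 i c j y z)
    have "distinct [i, c, j]" using 2(1) by auto
    from path_admittance[OF Y nn nodes this 2(2-4)] len
    have "\<exists>G s. (\<forall>e. 0 \<le> G e) \<and> card {e. e < 6 \<and> G e \<noteq> 0} \<le> 3 \<and> (\<forall>k. s k \<in> {1, -1}) \<and>
        path_matrix G s Y i c j"
      by (meson order_trans)
    then have ?path using 2(1) by (intro bexI[of _ "(i, c, j)"]) simp_all
    then show ?thesis ..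
  qed
next
  assume "?star \<or> ?path"
  then show "realizable_with_at_most 3 Y"
  proof
    assume ?star
    then show ?thesis using star_matrix_realizable[OF sym] by blast
  next
    assume ?path
    then obtain i c j G s where ijc: "(i, c, j) \<in> {(1, 2, 3), (1, 3, 2), (2, 1, 3 :: 3)}"
      and G: "\<forall>e. 0 \<le> G e" "card {e. e < 6 \<and> G e \<noteq> 0} \<le> 3" "\<forall>k. s k \<in> {1, -1}"
      and path: "path_matrix G s Y i c j"
      by blast
    from ijc have "distinct [i, c, j]" by auto
    with G path show ?thesis using path_matrix_realizable[OF sym] by blast
  qed
qed

theorem theorem1:
  fixes y11 y12 y13 y22 y23 y33 :: real and YN :: "real ^ 3 ^ 3"
  assumes YN: "YN = vector [vector [y11, y12, y13],
                            vector [y12, y22, y23],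
                            vector [y13, y23, y33]]"
  shows "realizable_with_at_most 3 YN \<longleftrightarrow>
    (y12 * y13 * y23 \<le> 0 \<and>
      y11 - \<bar>y12\<bar> - \<bar>y13\<bar> \<ge> 0 \<and>
      y22 - \<bar>y12\<bar> - \<bar>y23\<bar> \<ge> 0 \<and>
      y33 - \<bar>y13\<bar> - \<bar>y23\<bar> \<ge> 0 \<and>
      at_least_zero 3
        [y12, y13, y23,
         y11 - \<bar>y12\<bar> - \<bar>y13\<bar>,
         y22 - \<bar>y12\<bar> - \<bar>y23\<bar>,
         y33 - \<bar>y13\<bar> - \<bar>y23\<bar>])
    \<or>
    (y12 * y13 * y23 \<ge> 0 \<and>
      (inequalities_with_equalities 3
         [(- \<bar>y13\<bar>, 0),
          (\<bar>y13\<bar>, \<bar>y12\<bar>), (\<bar>y12\<bar>, y11),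
          (\<bar>y13\<bar>, \<bar>y23\<bar>), (\<bar>y23\<bar>, y33),
          (\<bar>y12\<bar> + \<bar>y23\<bar> - \<bar>y13\<bar>, y22)] \<or>
       inequalities_with_equalities 3
         [(- \<bar>y12\<bar>, 0),
          (\<bar>y12\<bar>, \<bar>y13\<bar>), (\<bar>y13\<bar>, y11),
          (\<bar>y12\<bar>, \<bar>y23\<bar>), (\<bar>y23\<bar>, y22),
          (\<bar>y13\<bar> + \<bar>y23\<bar> - \<bar>y12\<bar>, y33)] \<or>
       inequalities_with_equalities 3
         [(- \<bar>y23\<bar>, 0),
          (\<bar>y23\<bar>, \<bar>y12\<bar>), (\<bar>y12\<bar>, y22),
          (\<bar>y23\<bar>, \<bar>y13\<bar>), (\<bar>y13\<bar>, y33),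
          (\<bar>y12\<bar> + \<bar>y13\<bar> - \<bar>y23\<bar>, y11)]))"
proof -
  have entries: "YN $ 1 $ 1 = y11" "YN $ 1 $ 2 = y12" "YN $ 1 $ 3 = y13"
    "YN $ 2 $ 1 = y12" "YN $ 2 $ 2 = y22" "YN $ 2 $ 3 = y23"
    "YN $ 3 $ 1 = y13" "YN $ 3 $ 2 = y23" "YN $ 3 $ 3 = y33"
    unfolding YN by (simp_all add: vector_3)
  have sym: "YN $ k $ l = YN $ l $ k" for k l
    using exhaust_3[of k] exhaust_3[of l] by (auto simp: entries)
  have dist: "distinct [1, 2, 3 :: 3]" "distinct [1, 3, 2 :: 3]" "distinct [2, 1, 3 :: 3]"
    by simp_all
  \<comment> \<open>The middle ports 2, 3 and 1 give (a), (b) and (c), up to the order of factors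
    and summands.\<close>
  show ?thesis
    unfolding realizable_with_at_most_3_iff[OF sym] bex_simps prod.case star_matrix_iff[OF dist(1)]
      path_matrix_iff[OF dist(1)] path_matrix_iff[OF dist(2)] path_matrix_iff[OF dist(3)] entries
    by (simp only: mult.commute mult.left_commute mult.assoc add.commute) blast
qed

end
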